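(* Let $H$ be the separable infinite-dimensional Hilbert space and let $U,V$ be unitary operators on $H$. (a) Suppose that the spectrum $\sigma(V)$ has at least $5$ points. Then the following statements are equivalent: (1) there exists a $*$-isomorphism $\pi:C^*(U)\to C^*(V)$ with $\pi(U)=\lambda V$ or $\pi(U)=\lambda V^*$ for some $\lambda\in\mathbb{T}$; (2) $\sigma(U)=\lambda\,\sigma(V)$ or $\sigma(U)=\lambda\,\overline{\sigma(V)}$ for some $\lambda\in\mathbb{T}$; (3) $\mathcal{OS}y(U)$ is completely order isomorphic to $\mathcal{OS}y(V)$. (b) If $\sigma(V)$ has $3$ points or less, then $\mathcal{OS}y(U)$ is completely order isomorphic to $\mathcal{OS}y(V)$ if and only if $|\sigma(U)|=|\sigma(V)|$.
   Context: $\mathbb{T}$ is the unit circle in $\mathbb{C}$; $\sigma(U)$ is the spectrum of $U$; $\overline{\sigma(V)}=\{\bar z: z\in\sigma(V)\}$ (complex conjugates); $C^*(U)$ is the unital C*-algebra generated by $U$ in $B(H)$. For a unitary $U$ on $H$, $\mathcal{OS}y(U)$ is the operator system given by the linear span of $\{1,U,U^*\}$ in $B(H)$. An operator system is a closed unital self-adjoint subspace of a unital C*-algebra. A linear map $\phi:X\to Y$ between operator systems is unital completely positive if $\phi(1)=1$ and for all $n$ the amplification $M_n(X)\to M_n(Y)$, $[x_{ij}]\mapsto[\phi(x_{ij})]$, sends positive elements to positive elements; a complete order isomorphism is a bijective unital completely positive map with unital completely positive inverse. *)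

theory Defs
  imports "HOL-Analysis.Analysis"
begin

section \<open>Complex Hilbert spaces\<close>

class scaleC = scaleR +
  fixes scaleC :: "complex \<Rightarrow> 'a \<Rightarrow> 'a"  (infixr \<open>*\<^sub>C\<close> 75)

class complex_vector = scaleC + real_vector +
  assumes scaleC_add_right: "a *\<^sub>C (x + y) = a *\<^sub>C x + a *\<^sub>C y"
    and scaleC_add_left: "(a + b) *\<^sub>C x = a *\<^sub>C x + b *\<^sub>C x"
    and scaleC_scaleC: "a *\<^sub>C b *\<^sub>C x = (a * b) *\<^sub>C x"
    and scaleC_one: "1 *\<^sub>C x = x"
    and scaleR_scaleC: "r *\<^sub>R x = complex_of_real r *\<^sub>C x"

class complex_normed_vector = complex_vector + real_normed_vector +
  assumes norm_scaleC: "norm (a *\<^sub>C x) = cmod a * norm x"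

text \<open>The inner product is linear in its first argument; its last axiom says that it is
  positive definite and induces the norm.\<close>

class complex_inner = complex_normed_vector +
  fixes cinner :: "'a \<Rightarrow> 'a \<Rightarrow> complex"
  assumes cinner_commute: "cinner x y = cnj (cinner y x)"
    and cinner_add_left: "cinner (x + y) z = cinner x z + cinner y z"
    and cinner_scaleC_left: "cinner (a *\<^sub>C x) y = a * cinner x y"
    and cinner_self: "cinner x x = complex_of_real ((norm x)\<^sup>2)"

class chilbert_space = complex_inner + complete_space

global_interpretation complex_vector:
  vector_space "scaleC :: complex \<Rightarrow> 'a \<Rightarrow> 'a::complex_vector"
  defines cspan = complex_vector.span
  by unfold_locales
    (simp_all add: scaleC_add_right scaleC_add_left scaleC_scaleC scaleC_one)


section \<open>Bounded operators\<close>

text \<open>The library type of bounded operators consists of the real-linear ones. It carries the operator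
  norm; the complex-linear operators form the subset \<open>BH\<close>, which is B(H).\<close>

definition BH :: "('h::chilbert_space \<Rightarrow>\<^sub>L 'h) set" where
  "BH = {T :: 'h \<Rightarrow>\<^sub>L 'h. \<forall>c x. T (c *\<^sub>C x) = c *\<^sub>C T x}"

lemma bounded_linear_scaleC_right: "bounded_linear (\<lambda>x::'a::complex_normed_vector. c *\<^sub>C x)"
proof (rule bounded_linear_intro[where K = "cmod c"])
  fix x y :: 'a and r :: real
  show "c *\<^sub>C (x + y) = c *\<^sub>C x + c *\<^sub>C y" by (rule scaleC_add_right)
  show "c *\<^sub>C r *\<^sub>R x = r *\<^sub>R c *\<^sub>C x"
    by (simp add: scaleR_scaleC scaleC_scaleC mult.commute)
  show "norm (c *\<^sub>C x) \<le> norm x * cmod c" by (simp add: norm_scaleC mult.commute)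
qed

instantiation blinfun :: (real_normed_vector, complex_normed_vector) complex_vector
begin

lift_definition scaleC_blinfun :: "complex \<Rightarrow> ('a \<Rightarrow>\<^sub>L 'b) \<Rightarrow> ('a \<Rightarrow>\<^sub>L 'b)"
  is "\<lambda>c f x. c *\<^sub>C f x"
  by (rule bounded_linear_compose[OF bounded_linear_scaleC_right])

instance
  by standard (transfer, simp add: scaleC_add_right scaleC_add_left scaleC_scaleC scaleC_one
      flip: scaleR_scaleC)+

end

definition adj :: "('h::chilbert_space \<Rightarrow>\<^sub>L 'h) \<Rightarrow> ('h \<Rightarrow>\<^sub>L 'h)" where
  "adj T = (THE S :: 'h \<Rightarrow>\<^sub>L 'h. \<forall>x y. cinner (T x) y = cinner x (S y))"

definition unitary :: "('h::chilbert_space \<Rightarrow>\<^sub>L 'h) \<Rightarrow> bool" where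
  "unitary U \<longleftrightarrow> U \<in> BH \<and> adj U o\<^sub>L U = id_blinfun \<and> U o\<^sub>L adj U = id_blinfun"

definition spectrum :: "('h::chilbert_space \<Rightarrow>\<^sub>L 'h) \<Rightarrow> complex set" where
  "spectrum T = {z. \<not> (\<exists>S\<in>BH. S o\<^sub>L (T - z *\<^sub>C id_blinfun) = id_blinfun
                            \<and> (T - z *\<^sub>C id_blinfun) o\<^sub>L S = id_blinfun)}"


section \<open>Generated C*-algebras\<close>

definition unital_cstar_subalgebra :: "('h::chilbert_space \<Rightarrow>\<^sub>L 'h) set \<Rightarrow> bool" where
  "unital_cstar_subalgebra A \<longleftrightarrow>
     A \<subseteq> BH \<and> closed A \<and> id_blinfun \<in> A \<and>
     (\<forall>S\<in>A. \<forall>T\<in>A. S + T \<in> A \<and> S o\<^sub>L T \<in> A) \<and>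
     (\<forall>c. \<forall>T\<in>A. c *\<^sub>C T \<in> A) \<and>
     (\<forall>T\<in>A. adj T \<in> A)"

definition cstar_generated :: "('h::chilbert_space \<Rightarrow>\<^sub>L 'h) \<Rightarrow> ('h \<Rightarrow>\<^sub>L 'h) set" where
  "cstar_generated U = \<Inter>{A. unital_cstar_subalgebra A \<and> U \<in> A}"

definition star_isomorphism ::
  "('h::chilbert_space \<Rightarrow>\<^sub>L 'h) set \<Rightarrow> ('k::chilbert_space \<Rightarrow>\<^sub>L 'k) set
     \<Rightarrow> (('h \<Rightarrow>\<^sub>L 'h) \<Rightarrow> ('k \<Rightarrow>\<^sub>L 'k)) \<Rightarrow> bool" where
  "star_isomorphism A B \<pi> \<longleftrightarrow>
     bij_betw \<pi> A B \<and>
     (\<forall>S\<in>A. \<forall>T\<in>A. \<pi> (S + T) = \<pi> S + \<pi> T \<and> \<pi> (S o\<^sub>L T) = \<pi> S o\<^sub>L \<pi> T) \<and>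
     (\<forall>c. \<forall>T\<in>A. \<pi> (c *\<^sub>C T) = c *\<^sub>C \<pi> T) \<and>
     (\<forall>T\<in>A. \<pi> (adj T) = adj (\<pi> T))"


section \<open>Operator systems\<close>

text \<open>An n-by-n matrix of operators on H, indexed by \<open>i, j < n\<close>, is positive if it is positive as an
  operator on the n-fold direct sum of H. Entries outside this range are ignored.\<close>

definition matrix_positive :: "nat \<Rightarrow> (nat \<Rightarrow> nat \<Rightarrow> ('h::chilbert_space \<Rightarrow>\<^sub>L 'h)) \<Rightarrow> bool" where
  "matrix_positive n x \<longleftrightarrow>
     (\<forall>h :: nat \<Rightarrow> 'h. (\<Sum>i<n. \<Sum>j<n. cinner (blinfun_apply (x i j) (h j)) (h i)) \<in> \<real>\<^sub>\<ge>\<^sub>0)"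

definition unital_completely_positive ::
  "('h::chilbert_space \<Rightarrow>\<^sub>L 'h) set \<Rightarrow> ('k::chilbert_space \<Rightarrow>\<^sub>L 'k) set
     \<Rightarrow> (('h \<Rightarrow>\<^sub>L 'h) \<Rightarrow> ('k \<Rightarrow>\<^sub>L 'k)) \<Rightarrow> bool" where
  "unital_completely_positive X Y \<phi> \<longleftrightarrow>
     \<phi> ` X \<subseteq> Y \<and>
     (\<forall>S\<in>X. \<forall>T\<in>X. \<phi> (S + T) = \<phi> S + \<phi> T) \<and>
     (\<forall>c. \<forall>T\<in>X. \<phi> (c *\<^sub>C T) = c *\<^sub>C \<phi> T) \<and>
     \<phi> id_blinfun = id_blinfun \<and>
     (\<forall>n x. (\<forall>i<n. \<forall>j<n. x i j \<in> X) \<longrightarrow> matrix_positive n x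
        \<longrightarrow> matrix_positive n (\<lambda>i j. \<phi> (x i j)))"

definition complete_order_isomorphism ::
  "('h::chilbert_space \<Rightarrow>\<^sub>L 'h) set \<Rightarrow> ('k::chilbert_space \<Rightarrow>\<^sub>L 'k) set
     \<Rightarrow> (('h \<Rightarrow>\<^sub>L 'h) \<Rightarrow> ('k \<Rightarrow>\<^sub>L 'k)) \<Rightarrow> bool" where
  "complete_order_isomorphism X Y \<phi> \<longleftrightarrow>
     bij_betw \<phi> X Y \<and> unital_completely_positive X Y \<phi> \<and>
     unital_completely_positive Y X (inv_into X \<phi>)"

definition completely_order_isomorphic ::
  "('h::chilbert_space \<Rightarrow>\<^sub>L 'h) set \<Rightarrow> ('k::chilbert_space \<Rightarrow>\<^sub>L 'k) set \<Rightarrow> bool" where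
  "completely_order_isomorphic X Y \<longleftrightarrow> (\<exists>\<phi>. complete_order_isomorphism X Y \<phi>)"

definition OSy :: "('h::chilbert_space \<Rightarrow>\<^sub>L 'h) \<Rightarrow> ('h \<Rightarrow>\<^sub>L 'h) set" where
  "OSy U = cspan {id_blinfun, U, adj U}"

end

theory Submission
  imports "Jordan_Normal_Form.Determinant" "HOL-Computational_Algebra.Fundamental_Theorem_Algebra" Defs
begin

text \<open>For a unitary U everything is reduced to functions on its spectrum. The central fact is that a
  matrix of Laurent polynomials in U is positive iff it is positive semidefinite at each point of
  the spectrum: the infimum m of the quadratic form of a self-adjoint matrix X(U) is an approximate
  eigenvalue, so det (X(U) - m) is not bounded below; factoring this polynomial in U into linear
  factors gives a point r of the spectrum such that m is an eigenvalue of X(r). The scalar case shows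
  that the norm of q(U) is the maximum of |q| on the spectrum, so unitaries with equal spectra generate
  isomorphic C*-algebras.

  Complete order isomorphisms of the operator systems correspond to pairs of mutually inverse
  bijections of the spectra of the form a + b z + c cnj z: such a pair maps each spectrum into the
  convex hull of the other one and therefore preserves extreme points. If a function of this form has
  modulus 1 at five points of the circle, it is a rotation, possibly composed with conjugation; and
  any function on at most three points of the circle has this form.\<close>

section \<open>Adjoints\<close>

text \<open>Continuous functional calculus and characters are replaced by algebra. For normal
  operators a lower bound already yields an inverse, so points of the spectrum are approximate
  eigenvalues and invertibility is tested by estimates alone. A matrix has no linear factors to
  split off; its determinant, formed over the commutative ring of polynomials, makes one scalar
  polynomial responsible for the failure of the lower bound. Negative powers do not interfere, since
  powers of \<open>U\<close> are isometric. On the side of operator systems the obstacle is that 1,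
  \<open>U\<close> and \<open>adj U\<close> are linearly dependent when the spectrum has at most two
  points: an operator determines only the values of its function on the spectrum, not the
  coefficients. Operators and functions are therefore linked by relations (\<open>laurent\<close>,
  \<open>laurent_graph\<close>, \<open>pullback_rel\<close>), which norm estimates show to be
  single-valued where needed. The bounds 5 and 3 count coefficients: unimodularity of a + b z + c
  \<open>cnj\<close> z on the circle is a polynomial equation of degree at most 4, while the
  function itself has three free coefficients.\<close>

lemma cinner_add_right: "cinner x (y + z) = cinner x y + cinner (x::'h::complex_inner) z"
  by (metis cinner_add_left cinner_commute complex_cnj_add)

lemma cinner_scaleC_right: "cinner x (a *\<^sub>C y) = cnj a * cinner (x::'h::complex_inner) y"
  by (metis cinner_commute cinner_scaleC_left complex_cnj_mult)

lemma norm_add_sq: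
  "(norm (x + y))\<^sup>2 = (norm x)\<^sup>2 + (norm y)\<^sup>2 + 2 * Re (cinner (x::'h::complex_inner) y)"
proof -
  have "complex_of_real ((norm (x + y))\<^sup>2) = cinner (x + y) (x + y)"
    by (simp only: cinner_self)
  also have "\<dots> = cinner x x + cinner y y + (cinner x y + cnj (cinner x y))"
    by (simp add: cinner_add_left cinner_add_right cinner_commute[of y x])
  also have "\<dots> = complex_of_real ((norm x)\<^sup>2 + (norm y)\<^sup>2 + 2 * Re (cinner x y))"
    by (simp add: cinner_self complex_add_cnj)
  finally show ?thesis using of_real_eq_iff by blast
qed

lemma cinner_self_Re: "Re (cinner x x) = (norm (x::'h::complex_inner))\<^sup>2"
  by (simp add: cinner_self)

lemma cinner_Cauchy_Schwarz: "cmod (cinner x y) \<le> norm x * norm (y::'h::complex_inner)"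
proof (cases "y = 0")
  case True
  have "cinner x (0::'h) = 0"
    using cinner_add_right[of x 0 0] by simp
  then show ?thesis using True by simp
next
  case False
  define n where "n = (norm y)\<^sup>2"
  have n: "n > 0" using False by (simp add: n_def)
  \<comment> \<open>This choice makes \<open>x + a *\<^sub>C y\<close> orthogonal to
    \<open>y\<close>; the inequality is the nonnegativity of its squared norm.\<close>
  define a where "a = - cinner x y / of_real n"
  have "cinner x (a *\<^sub>C y) = - of_real ((cmod (cinner x y))\<^sup>2 / n)"
    unfolding cinner_scaleC_right using complex_norm_square[of "cinner x y"] by (simp add: a_def mult.commute)
  moreover have "norm (a *\<^sub>C y) = cmod (cinner x y) / n * norm y"
    using n by (simp add: norm_scaleC a_def norm_divide)
  moreover have "(cmod (cinner x y) / n * norm y)\<^sup>2 = (cmod (cinner x y))\<^sup>2 / n"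
    using n by (simp add: power_mult_distrib power_divide n_def[symmetric]) (simp add: power2_eq_square)
  moreover have "0 \<le> (norm (x + a *\<^sub>C y))\<^sup>2" by simp
  ultimately have "(cmod (cinner x y))\<^sup>2 / n \<le> (norm x)\<^sup>2"
    by (simp add: norm_add_sq)
  then have "(cmod (cinner x y))\<^sup>2 \<le> (norm x * norm y)\<^sup>2"
    using n by (simp add: field_simps n_def)
  then show ?thesis by (rule power2_le_imp_le) simp
qed

lemma bounded_bilinear_cinner: "bounded_bilinear (cinner :: 'h::complex_inner \<Rightarrow> 'h \<Rightarrow> complex)"
proof
  fix a a' b b' :: 'h and r :: real
  show "cinner (a + a') b = cinner a b + cinner a' b" by (rule cinner_add_left)
  show "cinner a (b + b') = cinner a b + cinner a b'" by (rule cinner_add_right)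
  show "cinner (r *\<^sub>R a) b = r *\<^sub>R cinner a b"
    by (simp add: scaleR_scaleC cinner_scaleC_left scaleR_conv_of_real)
  show "cinner a (r *\<^sub>R b) = r *\<^sub>R cinner a b"
    by (simp add: scaleR_scaleC cinner_scaleC_right scaleR_conv_of_real)
  show "\<exists>K. \<forall>(a::'h) b. norm (cinner a b) \<le> norm a * norm b * K"
    by (rule exI[of _ 1]) (simp add: cinner_Cauchy_Schwarz)
qed

interpretation cinner: bounded_bilinear "cinner :: 'h::complex_inner \<Rightarrow> 'h \<Rightarrow> complex"
  by (rule bounded_bilinear_cinner)

lemma cinner_ext:
  fixes x y :: "'h::complex_inner"
  assumes "\<And>z. cinner z x = cinner z y"
  shows "x = y"
proof -
  have "cinner (x - y) (x - y) = 0"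
    using assms[of "x - y"] by (simp add: cinner.diff_right)
  then show ?thesis by (simp add: cinner_self)
qed

text \<open>The representing vector is the minimiser of the functional \<open>J\<close>, so no
  orthogonal complement is needed: the parallelogram law makes minimising sequences Cauchy, and the
  first variation at the minimum identifies the real part of \<open>f\<close>.\<close>

lemma riesz_representation:
  fixes f :: "'h::chilbert_space \<Rightarrow> complex"
  assumes f: "bounded_linear f" and f_scaleC: "\<And>c x. f (c *\<^sub>C x) = c * f x"
  shows "\<exists>y. \<forall>x. f x = cinner x y"
proof -
  interpret f: bounded_linear f by (rule f)
  define J where "J x = (norm x)\<^sup>2 / 2 - Re (f x)" for x
  obtain K where K: "\<And>x. norm (f x) \<le> norm x * K" using f.bounded by blast
  have bdd: "- K\<^sup>2 / 2 \<le> J x" for x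
  proof -
    have "Re (f x) \<le> norm x * K" using complex_Re_le_cmod K order_trans by blast
    moreover have "0 \<le> (norm x - K)\<^sup>2" by simp
    ultimately show ?thesis unfolding J_def by (simp add: power2_diff)
  qed
  define m where "m = Inf (range J)"
  have bdd': "bdd_below (range J)" using bdd by (intro bdd_belowI2)
  have m_le: "m \<le> J x" for x unfolding m_def using bdd' by (simp add: cInf_lower)
  have "\<exists>x. J x < m + 1 / real (Suc n)" for n
    using cInf_lessD[of "range J" "m + 1 / real (Suc n)"] unfolding m_def by auto
  then obtain u where u: "\<And>n. J (u n) < m + 1 / real (Suc n)" by metis
  \<comment> \<open>Parallelogram law, with the value of \<open>J\<close> at the midpoint bounded
    below by \<open>m\<close>.\<close>
  have mid: "(norm (x - y))\<^sup>2 \<le> 4 * ((J x - m) + (J y - m))" for x y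
  proof -
    have "(norm (x + y))\<^sup>2 + (norm (x - y))\<^sup>2 = 2 * (norm x)\<^sup>2 + 2 * (norm y)\<^sup>2"
      using norm_add_sq[of x y] norm_add_sq[of x "-y"] by (simp add: cinner.minus_right)
    moreover have "J ((1/2) *\<^sub>R (x + y)) = (norm (x + y))\<^sup>2 / 8 - (Re (f x) + Re (f y)) / 2"
      unfolding J_def by (simp only: f.scaleR f.add norm_scaleR) (simp add: power_divide)
    ultimately show ?thesis using m_le[of "(1/2) *\<^sub>R (x + y)"] unfolding J_def by argo
  qed
  have "Cauchy u"
  proof (rule metric_CauchyI)
    fix e :: real assume e: "0 < e"
    obtain N where N: "1 / real (Suc N) < e\<^sup>2 / 8"
      using e nat_approx_posE[of "e\<^sup>2 / 8"] by auto
    have "dist (u i) (u j) < e" if "i \<ge> N" "j \<ge> N" for i j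
    proof -
      have "1 / real (Suc i) \<le> 1 / real (Suc N)" "1 / real (Suc j) \<le> 1 / real (Suc N)"
        using that by (simp_all add: frac_le)
      then have "J (u i) - m < e\<^sup>2 / 8" "J (u j) - m < e\<^sup>2 / 8"
        using u[of i] u[of j] N by simp_all
      then have "(norm (u i - u j))\<^sup>2 < e\<^sup>2"
        using mid[of "u i" "u j"] by simp
      then show ?thesis using e power_less_imp_less_base[of "norm (u i - u j)" 2 e]
        by (simp add: dist_norm)
    qed
    then show "\<exists>M. \<forall>i\<ge>M. \<forall>j\<ge>M. dist (u i) (u j) < e" by blast
  qed
  then obtain y where y: "u \<longlonglongrightarrow> y" using Cauchy_convergent convergent_def by blast
  have "(\<lambda>n. J (u n)) \<longlonglongrightarrow> J y"
    unfolding J_def by (intro tendsto_intros f.tendsto y) simp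
  moreover have "(\<lambda>n. m + 1 / real (Suc n)) \<longlonglongrightarrow> m + 0"
    by (intro tendsto_intros LIMSEQ_Suc[OF lim_1_over_n])
  ultimately have Jy: "J y \<le> m"
    using LIMSEQ_le[of "\<lambda>n. J (u n)" "J y" "\<lambda>n. m + 1 / real (Suc n)" m] u by (auto intro: less_imp_le)
  have re: "Re (f x) = Re (cinner x y)" for x
  proof -
    define d where "d = Re (cinner y x) - Re (f x)"
    have q: "0 \<le> t * d + t\<^sup>2 * ((norm x)\<^sup>2 / 2)" for t :: real
    proof -
      have "J (y + t *\<^sub>R x) = J y + t * d + t\<^sup>2 * ((norm x)\<^sup>2 / 2)"
        unfolding J_def d_def
        by (simp add: norm_add_sq f.add f.scaleR cinner.scaleR_right power_mult_distrib algebra_simps add_divide_distrib)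
      then show ?thesis using m_le[of "y + t *\<^sub>R x"] Jy by simp
    qed
    have "d = 0"
    proof (rule ccontr)
      assume "d \<noteq> 0"
      \<comment> \<open>At t = - d / n the quadratic in \<open>q\<close> equals - d^2 / n^2. The
        summand 1 keeps \<open>n\<close> positive and leaves exactly this negative
        remainder.\<close>
      define n where "n = (norm x)\<^sup>2 / 2 + 1"
      have n: "n > 0" by (simp add: n_def add_nonneg_pos)
      have "(- d / n) * d + (- d / n)\<^sup>2 * (n - 1) = - (d\<^sup>2 / n\<^sup>2)"
        using n by (simp add: field_simps power2_eq_square)
      moreover have "(norm x)\<^sup>2 / 2 = n - 1" by (simp add: n_def)
      ultimately have "d\<^sup>2 / n\<^sup>2 \<le> 0" using q[of "- d / n"] by (metis neg_0_le_iff_le)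
      moreover have "d\<^sup>2 / n\<^sup>2 > 0" using \<open>d \<noteq> 0\<close> n by simp
      ultimately show False by simp
    qed
    moreover have "Re (cinner y x) = Re (cinner x y)" by (subst cinner_commute) simp
    ultimately show ?thesis unfolding d_def by simp
  qed
  \<comment> \<open>Applying \<open>re\<close> to i x recovers the imaginary part.\<close>
  have "f x = cinner x y" for x
    using re[of x] re[of "\<i> *\<^sub>C x"] by (simp add: complex_eq_iff f_scaleC cinner_scaleC_left)
  then show ?thesis by blast
qed

section \<open>Complex-linear bounded operators and their adjoints\<close>

lemma BH_scaleC: "T \<in> BH \<Longrightarrow> blinfun_apply T (c *\<^sub>C x) = c *\<^sub>C blinfun_apply T x"
  by (simp add: BH_def)

lemma scaleC_zero_right [simp]: "a *\<^sub>C 0 = (0::'h::complex_vector)"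
  by (rule complex_vector.scale_zero_right)

lemma scaleC_zero_left [simp]: "0 *\<^sub>C x = (0::'h::complex_vector)"
  by (rule complex_vector.scale_zero_left)

lemma id_blinfun_BH [simp]: "id_blinfun \<in> BH"
  and BH_add: "S \<in> BH \<Longrightarrow> T \<in> BH \<Longrightarrow> S + T \<in> BH"
  and BH_compose: "S \<in> BH \<Longrightarrow> T \<in> BH \<Longrightarrow> S o\<^sub>L T \<in> BH"
  and BH_cscale: "T \<in> BH \<Longrightarrow> c *\<^sub>C T \<in> BH"
  by (auto simp: BH_def blinfun.add_left scaleC_add_right scaleC_blinfun.rep_eq scaleC_scaleC mult.commute)

lemma BH_diff: "S \<in> BH \<Longrightarrow> T \<in> BH \<Longrightarrow> S - T \<in> BH"
  by (auto simp: BH_def blinfun.diff_left complex_vector.scale_right_diff_distrib)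

lemma BH_tendsto:
  assumes "X \<longlonglongrightarrow> T" "\<And>n::nat. X n \<in> BH" shows "T \<in> BH"
proof -
  have "T (c *\<^sub>C x) = c *\<^sub>C T x" for c x
  proof (rule LIMSEQ_unique)
    show "(\<lambda>n. X n (c *\<^sub>C x)) \<longlonglongrightarrow> T (c *\<^sub>C x)"
      by (intro blinfun.tendsto assms tendsto_intros)
    show "(\<lambda>n. X n (c *\<^sub>C x)) \<longlonglongrightarrow> c *\<^sub>C T x"
      by (simp only: assms(2)[THEN BH_scaleC])
        (intro bounded_linear.tendsto[OF bounded_linear_scaleC_right] blinfun.tendsto assms tendsto_intros)
  qed
  then show ?thesis by (simp add: BH_def)
qed

text \<open>As \<open>adj\<close> is a definite description, every identity for adjoints is proved
  by exhibiting an operator with the defining property; \<open>cinner_ext\<close> gives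
  uniqueness.\<close>

lemma adj_eqI:
  assumes "\<And>x y. cinner (blinfun_apply T x) y = cinner x (blinfun_apply S y)" shows "adj T = S"
  unfolding adj_def
proof (rule the_equality)
  fix S' :: "'a \<Rightarrow>\<^sub>L 'a" assume *: "\<forall>x y. cinner (T x) y = cinner x (S' y)"
  have "S' y = S y" for y by (rule cinner_ext) (metis * assms)
  then show "S' = S" by (rule blinfun_eqI)
qed (use assms in blast)

text \<open>Riesz representation of x \<mapsto> <T x, y> for each y. Linearity of the resulting map
  follows from uniqueness, and its bound from the Cauchy-Schwarz inequality at x = s y.\<close>

lemma adjoint_exists:
  fixes T :: "'h::chilbert_space \<Rightarrow>\<^sub>L 'h"
  assumes T: "T \<in> BH"
  shows "\<exists>S\<in>BH. \<forall>x y. cinner (T x) y = cinner x (blinfun_apply S y)"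
proof -
  have "\<exists>z. \<forall>x. cinner (T x) y = cinner x z" for y
  proof (rule riesz_representation)
    show "bounded_linear (\<lambda>x. cinner (T x) y)"
      by (rule bounded_linear_compose[OF cinner.bounded_linear_left]) (rule blinfun.bounded_linear_right)
  qed (simp add: T[THEN BH_scaleC] cinner_scaleC_left)
  then obtain s where s: "\<And>x y. cinner (T x) y = cinner x (s y)" by metis
  have add: "s (x + y) = s x + s y" for x y
    by (rule cinner_ext) (simp add: s[symmetric] cinner_add_right)
  have scale: "s (c *\<^sub>C x) = c *\<^sub>C s x" for c x
    by (rule cinner_ext) (simp add: s[symmetric] cinner_scaleC_right)
  have "norm (s y) \<le> norm y * norm T" for y
  proof (cases "s y = 0")
    case False
    have "(norm (s y))\<^sup>2 = cmod (cinner (T (s y)) y)"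
      by (simp add: s cinner_self norm_power)
    also have "\<dots> \<le> norm (T (s y)) * norm y" by (rule cinner_Cauchy_Schwarz)
    also have "\<dots> \<le> (norm T * norm (s y)) * norm y"
      by (intro mult_right_mono norm_blinfun) simp
    finally show ?thesis using False by (simp add: power2_eq_square mult.commute mult.left_commute)
  qed simp
  then have bl: "bounded_linear s"
    by (intro bounded_linear_intro[where K = "norm T"]) (auto simp: add scale scaleR_scaleC)
  show ?thesis
    by (rule bexI[of _ "Blinfun s"]) (auto simp: bounded_linear_Blinfun_apply[OF bl] s BH_def scale)
qed

lemma cinner_adj: "T \<in> BH \<Longrightarrow> cinner (blinfun_apply T x) y = cinner x (blinfun_apply (adj T) y)"
  and adj_BH: "T \<in> BH \<Longrightarrow> adj T \<in> BH"
proof -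
  assume "T \<in> BH"
  then obtain S where S: "S \<in> BH" "\<forall>x y. cinner (T x) y = cinner x (blinfun_apply S y)"
    using adjoint_exists by blast
  then have "adj T = S" by (intro adj_eqI) blast
  with S show "cinner (blinfun_apply T x) y = cinner x (blinfun_apply (adj T) y)" "adj T \<in> BH" by auto
qed

lemma cinner_adj': "T \<in> BH \<Longrightarrow> cinner (blinfun_apply (adj T) x) y = cinner x (blinfun_apply T y)"
  by (metis cinner_adj cinner_commute)

lemma adj_adj: "T \<in> BH \<Longrightarrow> adj (adj T) = T"
  by (rule adj_eqI) (rule cinner_adj')

lemma adj_id [simp]: "adj id_blinfun = id_blinfun"
  by (rule adj_eqI) simp

lemma adj_add: "S \<in> BH \<Longrightarrow> T \<in> BH \<Longrightarrow> adj (S + T) = adj S + adj T"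
  by (rule adj_eqI) (simp add: blinfun.add_left cinner_add_left cinner_add_right cinner_adj)

lemma adj_diff: "S \<in> BH \<Longrightarrow> T \<in> BH \<Longrightarrow> adj (S - T) = adj S - adj T"
  by (rule adj_eqI) (simp add: blinfun.diff_left cinner.diff_left cinner.diff_right cinner_adj)

lemma adj_scaleC: "T \<in> BH \<Longrightarrow> adj (c *\<^sub>C T) = cnj c *\<^sub>C adj T"
  by (rule adj_eqI) (simp add: scaleC_blinfun.rep_eq cinner_scaleC_left cinner_scaleC_right cinner_adj)

lemma adj_compose: "S \<in> BH \<Longrightarrow> T \<in> BH \<Longrightarrow> adj (S o\<^sub>L T) = adj T o\<^sub>L adj S"
  by (rule adj_eqI) (simp add: cinner_adj)

lemma norm_adj: "T \<in> BH \<Longrightarrow> norm (adj T) = norm (T :: 'h::chilbert_space \<Rightarrow>\<^sub>L 'h)"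
proof -
  have *: "norm (adj T) \<le> norm T" if T: "T \<in> BH" for T :: "'h::chilbert_space \<Rightarrow>\<^sub>L 'h"
  proof (rule norm_blinfun_bound)
    fix y
    show "norm (adj T y) \<le> norm T * norm y"
    proof (cases "adj T y = 0")
      case False
      have "(norm (adj T y))\<^sup>2 = cmod (cinner (T (adj T y)) y)"
        by (simp add: cinner_adj T cinner_self norm_power)
      also have "\<dots> \<le> norm (T (adj T y)) * norm y" by (rule cinner_Cauchy_Schwarz)
      also have "\<dots> \<le> (norm T * norm (adj T y)) * norm y"
        by (intro mult_right_mono norm_blinfun) simp
      finally show ?thesis using False by (simp add: power2_eq_square mult.commute mult.left_commute)
    qed simp
  qed simp
  assume "T \<in> BH"
  then show ?thesis using *[of T] *[of "adj T"] by (simp add: adj_adj adj_BH)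
qed

lemma adj_tendsto:
  assumes "X \<longlonglongrightarrow> T" "\<And>n::nat. X n \<in> BH"
  shows "(\<lambda>n. adj (X n)) \<longlonglongrightarrow> adj T"
proof -
  have T: "T \<in> BH" using assms by (rule BH_tendsto)
  have "norm (adj (X n) - adj T) = norm (X n - T)" for n
    by (simp add: T assms(2) BH_diff norm_adj flip: adj_diff)
  then show ?thesis using assms(1) by (simp add: tendsto_iff dist_norm)
qed

section \<open>Spectra of unitary operators\<close>

text \<open>The working substitute for invertibility: it passes to composites, it needs no inverse
  to be produced, and its failure is a statement about approximate eigenvectors.\<close>

definition bounded_below :: "('a::real_normed_vector \<Rightarrow>\<^sub>L 'b::real_normed_vector) \<Rightarrow> bool" where
  "bounded_below T \<longleftrightarrow> (\<exists>e>0. \<forall>x. e * norm x \<le> norm (T x))"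

lemma bounded_below_compose:
  assumes "bounded_below S" "bounded_below T" shows "bounded_below (S o\<^sub>L T)"
proof -
  obtain d where d: "d > 0" "\<And>x. d * norm x \<le> norm (S x)" using assms(1) by (auto simp: bounded_below_def)
  obtain e where e: "e > 0" "\<And>x. e * norm x \<le> norm (T x)" using assms(2) by (auto simp: bounded_below_def)
  have "(d * e) * norm x \<le> norm (S (T x))" for x
    using order_trans[OF mult_left_mono[OF e(2)[of x], of d] d(2)[of "T x"]] d(1) by (simp add: mult.assoc)
  then show ?thesis unfolding bounded_below_def using d e by (intro exI[of _ "d * e"]) auto
qed

text \<open>The lower bound gives <x, N x> \<ge> e^2 |x|^2 for \<open>N = adj T o\<^sub>L T\<close>,
  so x - t N x is a strict contraction for suitable t, and Banach's fixed point theorem solves N x =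
  y. Normality turns this solution into a preimage of y under \<open>T\<close>.\<close>

lemma normal_bounded_below_surj:
  fixes T :: "'h::chilbert_space \<Rightarrow>\<^sub>L 'h"
  assumes T: "T \<in> BH" and normal: "adj T o\<^sub>L T = T o\<^sub>L adj T" and bb: "bounded_below T"
  shows "\<exists>x. T x = y"
proof -
  obtain e where e: "e > 0" "\<And>x. e * norm x \<le> norm (T x)" using bb by (auto simp: bounded_below_def)
  define N where "N = adj T o\<^sub>L T"
  define K where "K = norm N + 1"
  have K: "K > 0" by (simp add: K_def add_nonneg_pos)
  \<comment> \<open>The value of t that minimises 1 + t^2 K^2 - 2 t e^2, the bound for the squared
    contraction factor. The maximum with 0 in \<open>q\<close> keeps its square root a legitimate
    factor.\<close>
  define t where "t = e\<^sup>2 / K\<^sup>2"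
  define q where "q = max 0 (1 - e\<^sup>2 * e\<^sup>2 / K\<^sup>2)"
  have t: "t > 0" using e K by (simp add: t_def)
  have q: "0 \<le> q" "q < 1" using e K by (auto simp: q_def)
  have contr: "norm (x - t *\<^sub>R N x) \<le> sqrt q * norm x" for x
  proof -
    have "cinner x (N x) = of_real ((norm (T x))\<^sup>2)"
      by (simp add: N_def cinner_self T flip: cinner_adj)
    then have "(norm (x - t *\<^sub>R N x))\<^sup>2 = (norm x)\<^sup>2 + t\<^sup>2 * (norm (N x))\<^sup>2 - 2 * t * (norm (T x))\<^sup>2"
      using norm_add_sq[of x "- t *\<^sub>R N x"]
      by (simp add: cinner.minus_right cinner.scaleR_right power_mult_distrib)
    also have "\<dots> \<le> (norm x)\<^sup>2 + t\<^sup>2 * (K * norm x)\<^sup>2 - 2 * t * (e * norm x)\<^sup>2"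
    proof -
      have "norm (N x) \<le> K * norm x"
        using norm_blinfun[of N x] mult_right_mono[of "norm N" K "norm x"] by (simp add: K_def)
      then have "(norm (N x))\<^sup>2 \<le> (K * norm x)\<^sup>2" by (intro power_mono) auto
      moreover have "(e * norm x)\<^sup>2 \<le> (norm (T x))\<^sup>2" using e by (intro power_mono) auto
      ultimately show ?thesis using t by (intro add_mono diff_mono mult_left_mono) auto
    qed
    also have "\<dots> = (1 - e\<^sup>2 * e\<^sup>2 / K\<^sup>2) * (norm x)\<^sup>2"
      using K by (simp add: t_def field_simps power2_eq_square)
    also have "\<dots> \<le> q * (norm x)\<^sup>2" by (intro mult_right_mono) (auto simp: q_def)
    also have "\<dots> = (sqrt q * norm x)\<^sup>2" using q by (simp add: power_mult_distrib)
    finally show ?thesis by (rule power2_le_imp_le) (use q in auto)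
  qed
  define g where "g x = x - t *\<^sub>R (N x - y)" for x
  have "\<exists>!x. g x = x"
  proof (rule banach_fix_type[where c = "sqrt q"])
    show "sqrt q < 1" "0 \<le> sqrt q" using q by auto
    show "\<forall>x y. dist (g x) (g y) \<le> sqrt q * dist x y"
    proof (intro allI)
      fix u v
      have "g u - g v = (u - v) - t *\<^sub>R N (u - v)"
        by (simp add: g_def blinfun.diff_right scaleR_diff_right)
      then show "dist (g u) (g v) \<le> sqrt q * dist u v" using contr[of "u - v"] by (simp add: dist_norm)
    qed
  qed
  then obtain x where "g x = x" by blast
  then have "N x = y" using t by (simp add: g_def)
  then have "T (adj T x) = y" using normal by (metis N_def blinfun_apply_blinfun_compose)
  then show ?thesis by blast
qed

lemma normal_bounded_below_invertible:
  fixes T :: "'h::chilbert_space \<Rightarrow>\<^sub>L 'h"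
  assumes T: "T \<in> BH" and normal: "adj T o\<^sub>L T = T o\<^sub>L adj T" and bb: "bounded_below T"
  shows "\<exists>S\<in>BH. S o\<^sub>L T = id_blinfun \<and> T o\<^sub>L S = id_blinfun"
proof -
  obtain e where e: "e > 0" "\<And>x. e * norm x \<le> norm (T x)" using bb by (auto simp: bounded_below_def)
  have inj: "x = y" if "T x = T y" for x y
    using e(1) e(2)[of "x - y"] that by (simp add: blinfun.diff_right mult_le_0_iff)
  obtain s where s: "\<And>y. T (s y) = y" using normal_bounded_below_surj[OF assms] by metis
  have sT: "s (T x) = x" for x by (rule inj) (simp add: s)
  have scale: "s (c *\<^sub>C x) = c *\<^sub>C s x" for c x by (rule inj) (simp add: s BH_scaleC[OF T])
  have "bounded_linear s"
  proof (rule bounded_linear_intro[where K = "1 / e"])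
    show "s (x + y) = s x + s y" for x y by (rule inj) (simp add: s blinfun.add_right)
    show "s (r *\<^sub>R x) = r *\<^sub>R s x" for r x by (simp add: scale scaleR_scaleC)
    show "norm (s x) \<le> norm x * (1 / e)" for x using e(2)[of "s x"] e(1) by (simp add: s field_simps)
  qed
  note ap = bounded_linear_Blinfun_apply[OF this]
  show ?thesis
    by (rule bexI[of _ "Blinfun s"]) (auto simp: ap s sT scale BH_def intro!: blinfun_eqI)
qed

section \<open>The spectrum of a unitary as its set of approximate eigenvalues\<close>

context
  fixes U :: "'h::chilbert_space \<Rightarrow>\<^sub>L 'h"
  assumes U: "unitary U"
begin

lemma unitary_BH: "U \<in> BH" and unitary_adj_BH: "adj U \<in> BH"
  using U by (auto simp: unitary_def adj_BH)

lemma unitary_adj_apply [simp]: "adj U (U x) = x" and unitary_apply_adj [simp]: "U (adj U x) = x"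
  using U by (metis unitary_def blinfun_apply_blinfun_compose blinfun_apply_id_blinfun id_apply)+

lemma unitary_norm [simp]: "norm (U x) = norm x"
proof -
  have "complex_of_real ((norm (U x))\<^sup>2) = cinner (U x) (U x)" by (simp only: cinner_self)
  also have "\<dots> = cinner x (adj U (U x))" by (rule cinner_adj[OF unitary_BH])
  also have "\<dots> = of_real ((norm x)\<^sup>2)" by (simp only: unitary_adj_apply cinner_self)
  finally show ?thesis by (metis norm_ge_zero of_real_eq_iff power2_eq_iff_nonneg)
qed

lemma unitary_adj_norm [simp]: "norm (adj U x) = norm x"
  by (metis unitary_norm unitary_apply_adj)

lemma unitary_adj: "unitary (adj U)"
  using U by (auto simp: unitary_def adj_BH adj_adj)

lemma unitary_cscale: "cmod c = 1 \<Longrightarrow> unitary (c *\<^sub>C U)"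
  using U complex_norm_square[of c]
  by (auto simp: unitary_def BH_cscale adj_scaleC scaleC_blinfun.rep_eq scaleC_scaleC scaleC_one
      BH_scaleC adj_BH mult.commute intro!: blinfun_eqI)

lemma shift_BH: "U - z *\<^sub>C id_blinfun \<in> BH"
  by (intro BH_diff unitary_BH BH_cscale id_blinfun_BH)

lemma shift_apply: "(U - z *\<^sub>C id_blinfun) x = U x - z *\<^sub>C x"
  by (simp add: blinfun.diff_left scaleC_blinfun.rep_eq)

text \<open>U - z is normal, so a lower bound already produces an inverse in \<open>BH\<close>.
  Conversely a left inverse S gives the lower bound 1 / (|S| + 1), where the summand 1 avoids
  division by zero.\<close>

lemma spectrum_iff_not_bounded_below: "z \<in> spectrum U \<longleftrightarrow> \<not> bounded_below (U - z *\<^sub>C id_blinfun)"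
proof -
  let ?T = "U - z *\<^sub>C id_blinfun"
  have ad: "adj ?T = adj U - cnj z *\<^sub>C id_blinfun"
    by (simp add: adj_diff unitary_BH BH_cscale adj_scaleC)
  have normal: "adj ?T o\<^sub>L ?T = ?T o\<^sub>L adj ?T"
    unfolding ad by (rule blinfun_eqI)
      (simp add: blinfun.diff_left blinfun.diff_right scaleC_blinfun.rep_eq scaleC_scaleC
        BH_scaleC[OF unitary_BH] BH_scaleC[OF unitary_adj_BH] mult.commute
        complex_vector.scale_right_diff_distrib)
  have "bounded_below ?T" if "S o\<^sub>L ?T = id_blinfun" for S
  proof -
    have "1 / (norm S + 1) * norm x \<le> norm (?T x)" for x
    proof -
      have "norm x = norm (S (?T x))"
        using that by (metis blinfun_apply_blinfun_compose blinfun_apply_id_blinfun id_apply)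
      also have "\<dots> \<le> norm S * norm (?T x)" by (rule norm_blinfun)
      also have "\<dots> \<le> (norm S + 1) * norm (?T x)" by (simp add: mult_right_mono)
      finally have "norm x / (norm S + 1) \<le> norm (?T x)"
        by (subst pos_divide_le_eq) (auto simp: mult.commute add_nonneg_pos)
      then show ?thesis by simp
    qed
    then show ?thesis unfolding bounded_below_def
      by (intro exI[of _ "1 / (norm S + 1)"]) (simp add: add_nonneg_pos)
  qed
  then show ?thesis
    unfolding spectrum_def using normal_bounded_below_invertible[OF shift_BH normal] by blast
qed

text \<open>Off the circle the reverse triangle inequality gives U - z the lower bound |1 -
  |z||.\<close>

lemma spectrum_norm: "z \<in> spectrum U \<Longrightarrow> cmod z = 1"
proof (rule ccontr)
  assume z: "z \<in> spectrum U" "cmod z \<noteq> 1"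
  have "\<bar>1 - cmod z\<bar> * norm x \<le> norm ((U - z *\<^sub>C id_blinfun) x)" for x
  proof -
    have "\<bar>1 - cmod z\<bar> * norm x = \<bar>norm (U x) - norm (z *\<^sub>C x)\<bar>"
      by (simp add: norm_scaleC left_diff_distrib abs_mult flip: abs_mult_pos)
        (metis abs_mult_pos left_diff_distrib mult_1 norm_ge_zero)
    then show ?thesis using norm_triangle_ineq3[of "U x" "z *\<^sub>C x"] by (simp add: shift_apply)
  qed
  then have "bounded_below (U - z *\<^sub>C id_blinfun)"
    unfolding bounded_below_def using z by (intro exI[of _ "\<bar>1 - cmod z\<bar>"]) auto
  then show False using z spectrum_iff_not_bounded_below by blast
qed

lemma spectrum_iff_approximate_eigenvalue:
  "z \<in> spectrum U \<longleftrightarrow> (\<forall>e>0. \<exists>x. norm x = 1 \<and> norm (U x - z *\<^sub>C x) < e)"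
proof
  assume z: "z \<in> spectrum U"
  show "\<forall>e>0. \<exists>x. norm x = 1 \<and> norm (U x - z *\<^sub>C x) < e"
  proof (intro allI impI)
    fix e :: real assume "e > 0"
    then obtain x where x: "norm (U x - z *\<^sub>C x) < e * norm x"
      using z spectrum_iff_not_bounded_below[of z] unfolding bounded_below_def shift_apply
      by (metis linorder_not_le)
    then have "x \<noteq> 0" by auto
    let ?y = "(1 / norm x) *\<^sub>R x"
    have "U ?y - z *\<^sub>C ?y = (1 / norm x) *\<^sub>R (U x - z *\<^sub>C x)"
      by (simp add: BH_scaleC[OF unitary_BH] scaleR_scaleC scaleC_scaleC mult.commute
          complex_vector.scale_right_diff_distrib)
    then have "norm (U ?y - z *\<^sub>C ?y) = norm (U x - z *\<^sub>C x) / norm x" by (simp only: norm_scaleR) simp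
    then have "norm (U ?y - z *\<^sub>C ?y) < e"
      using x \<open>x \<noteq> 0\<close> by (simp add: pos_divide_less_eq del: blinfun.scaleR_right)
    then show "\<exists>x. norm x = 1 \<and> norm (U x - z *\<^sub>C x) < e"
      using \<open>x \<noteq> 0\<close> by (intro exI[of _ ?y]) simp
  qed
next
  assume *: "\<forall>e>0. \<exists>x. norm x = 1 \<and> norm (U x - z *\<^sub>C x) < e"
  have "\<not> bounded_below (U - z *\<^sub>C id_blinfun)"
    unfolding bounded_below_def shift_apply using * by (metis linorder_not_le mult.right_neutral)
  then show "z \<in> spectrum U" using spectrum_iff_not_bounded_below by blast
qed

end

lemma spectrum_cscale:
  assumes U: "unitary (U :: 'h::chilbert_space \<Rightarrow>\<^sub>L 'h)" and c: "cmod c = 1"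
  shows "spectrum (c *\<^sub>C U) = (\<lambda>z. c * z) ` spectrum U"
proof -
  have iff: "c * z \<in> spectrum (c *\<^sub>C U) \<longleftrightarrow> z \<in> spectrum U" for z
  proof -
    have "norm ((c *\<^sub>C U) x - (c * z) *\<^sub>C x) = norm (U x - z *\<^sub>C x)" for x
    proof -
      have "(c *\<^sub>C U) x - (c * z) *\<^sub>C x = c *\<^sub>C (U x - z *\<^sub>C x)"
        by (simp add: scaleC_blinfun.rep_eq complex_vector.scale_right_diff_distrib scaleC_scaleC)
      then show ?thesis using c by (simp add: norm_scaleC)
    qed
    then show ?thesis
      by (simp add: spectrum_iff_approximate_eigenvalue U unitary_cscale[OF U c])
  qed
  have "c \<noteq> 0" using c by auto
  then have "z \<in> spectrum (c *\<^sub>C U) \<longleftrightarrow> z \<in> (\<lambda>z. c * z) ` spectrum U" for z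
    using iff[of "z / c"] iff by auto (metis image_eqI nonzero_mult_div_cancel_left times_divide_eq_right)
  then show ?thesis by blast
qed

text \<open>The isometry z U maps \<open>adj U x - cnj z *\<^sub>C x\<close> to z x - U x, so the
  same vectors are approximate eigenvectors of \<open>U\<close> and of \<open>adj U\<close>. The
  reverse inclusion is this argument for \<open>adj U\<close>.\<close>

lemma spectrum_adj:
  assumes U: "unitary (U :: 'h::chilbert_space \<Rightarrow>\<^sub>L 'h)"
  shows "spectrum (adj U) = cnj ` spectrum U"
proof -
  have *: "cnj z \<in> spectrum (adj U)" if z: "z \<in> spectrum U" and U: "unitary U"
    for z and U :: "'h \<Rightarrow>\<^sub>L 'h"
  proof -
    have "norm (adj U x - cnj z *\<^sub>C x) = norm (U x - z *\<^sub>C x)" for x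
    proof -
      have "norm (adj U x - cnj z *\<^sub>C x) = norm (z *\<^sub>C U (adj U x - cnj z *\<^sub>C x))"
        using spectrum_norm[OF U z] by (simp add: norm_scaleC U)
      also have "z *\<^sub>C U (adj U x - cnj z *\<^sub>C x) = z *\<^sub>C x - U x"
        using spectrum_norm[OF U z] complex_norm_square[of z]
        by (simp add: blinfun.diff_right U BH_scaleC[OF unitary_BH[OF U]] scaleC_scaleC scaleC_one
            complex_vector.scale_right_diff_distrib)
      finally show ?thesis by (simp add: norm_minus_commute)
    qed
    then show ?thesis using z U by (simp add: spectrum_iff_approximate_eigenvalue unitary_adj)
  qed
  show ?thesis
  proof
    show "cnj ` spectrum U \<subseteq> spectrum (adj U)" using * U by blast
    show "spectrum (adj U) \<subseteq> cnj ` spectrum U"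
      using *[OF _ unitary_adj[OF U]] U unitary_BH[OF U] by (force simp: adj_adj image_iff)
  qed
qed

section \<open>Polynomials and Laurent polynomials in an operator\<close>

definition poly_op :: "('h::chilbert_space \<Rightarrow>\<^sub>L 'h) \<Rightarrow> complex poly \<Rightarrow> ('h \<Rightarrow>\<^sub>L 'h)" where
  "poly_op T p = fold_coeffs (\<lambda>a S. a *\<^sub>C id_blinfun + (T o\<^sub>L S)) p 0"

lemma poly_op_0 [simp]: "poly_op T 0 = 0"
  by (simp add: poly_op_def)

lemma poly_op_pCons [simp]: "poly_op T (pCons a p) x = a *\<^sub>C x + T (poly_op T p x)"
  by (cases "p = 0 \<and> a = 0")
    (auto simp: poly_op_def blinfun.add_left blinfun.zero_left blinfun.zero_right scaleC_blinfun.rep_eq)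

lemma poly_op_1 [simp]: "poly_op T 1 x = x"
  by (simp add: one_pCons scaleC_one blinfun.zero_left blinfun.zero_right)

lemma poly_op_add: "poly_op T (p + q) x = poly_op T p x + poly_op T q x"
  by (induction p q rule: poly_induct2)
    (simp_all add: blinfun.add_left blinfun.add_right scaleC_add_left)

context
  fixes T :: "'h::chilbert_space \<Rightarrow>\<^sub>L 'h"
  assumes T: "T \<in> BH"
begin

lemma poly_op_smult: "poly_op T (smult c p) x = c *\<^sub>C poly_op T p x"
  by (induction p)
    (simp_all add: blinfun.zero_left BH_scaleC[OF T] scaleC_add_right scaleC_scaleC)

lemma poly_op_mult: "poly_op T (p * q) x = poly_op T p (poly_op T q x)"
  by (induction p) (simp_all add: blinfun.zero_left mult_pCons_left poly_op_add poly_op_smult)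

lemma poly_op_sum: "poly_op T (\<Sum>i\<in>I. p i) x = (\<Sum>i\<in>I. poly_op T (p i) x)"
  by (induction I rule: infinite_finite_induct) (simp_all add: blinfun.zero_left poly_op_add)

lemma poly_op_diff: "poly_op T (p - q) x = poly_op T p x - poly_op T q x"
  using poly_op_add[of T p "smult (-1) q" x] poly_op_smult[of "-1" q x] by simp

lemma poly_op_BH: "poly_op T p \<in> BH"
  by (induction p)
    (auto simp: BH_def poly_op_pCons scaleC_add_right scaleC_scaleC mult.commute BH_scaleC[OF T])

lemma poly_op_commute: "poly_op T p (poly_op T q x) = poly_op T q (poly_op T p x)"
  by (metis poly_op_mult mult.commute)

text \<open>Over the complex numbers \<open>p\<close> splits into linear factors, and a composite of
  operators bounded below is bounded below; the induction on the degree removes one root at a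
  time.\<close>

lemma bounded_below_poly_op:
  assumes "p \<noteq> 0" "\<And>r. poly p r = 0 \<Longrightarrow> bounded_below (T - r *\<^sub>C id_blinfun)"
  shows "bounded_below (poly_op T p)"
  using assms
proof (induction "degree p" arbitrary: p rule: less_induct)
  case less
  show ?case
  proof (cases "degree p = 0")
    case True
    then obtain a where a: "p = [:a:]" by (metis degree_eq_zeroE)
    with less.prems show ?thesis
      unfolding bounded_below_def
      by (intro exI[of _ "cmod a"]) (simp add: norm_scaleC blinfun.zero_left blinfun.zero_right)
  next
    case False
    then obtain r where r: "poly p r = 0"
      by (metis constant_degree fundamental_theorem_of_algebra)
    then obtain q where q: "p = [:- r, 1:] * q" by (metis poly_eq_0_iff_dvd dvdE)
    then have "q \<noteq> 0" using less.prems by auto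
    then have "degree p = Suc (degree q)" unfolding q by (subst degree_mult_eq) auto
    then have bq: "bounded_below (poly_op T q)"
      using less.hyps[of q] less.prems \<open>q \<noteq> 0\<close> unfolding q by (simp add: poly_mult)
    have "poly_op T p = (T - r *\<^sub>C id_blinfun) o\<^sub>L poly_op T q"
    proof (rule blinfun_eqI)
      fix x
      have "poly_op T p x = poly_op T [:- r, 1:] (poly_op T q x)" unfolding q by (rule poly_op_mult)
      then show "poly_op T p x = ((T - r *\<^sub>C id_blinfun) o\<^sub>L poly_op T q) x"
        by (simp add: blinfun.diff_left scaleC_blinfun.rep_eq scaleC_one blinfun.zero_left blinfun.zero_right)
    qed
    then show ?thesis using bounded_below_compose[OF less.prems(2)[OF r] bq] by simp
  qed
qed

end

text \<open>A relation between functions and operators, with no normal form: z * \<open>cnj\<close>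
  z and the constant 1 are different functions on the plane but belong to the same operator. Only
  values on the circle matter, and facts about both sides are proved by one induction.\<close>

inductive laurent :: "('h::chilbert_space \<Rightarrow>\<^sub>L 'h) \<Rightarrow> (complex \<Rightarrow> complex) \<Rightarrow> ('h \<Rightarrow>\<^sub>L 'h) \<Rightarrow> bool"
  for U where
  laurent_const: "laurent U (\<lambda>z. c) (c *\<^sub>C id_blinfun)"
| laurent_gen: "laurent U (\<lambda>z. z) U"
| laurent_cnj: "laurent U cnj (adj U)"
| laurent_add: "laurent U q S \<Longrightarrow> laurent U r T \<Longrightarrow> laurent U (\<lambda>z. q z + r z) (S + T)"
| laurent_mult: "laurent U q S \<Longrightarrow> laurent U r T \<Longrightarrow> laurent U (\<lambda>z. q z * r z) (S o\<^sub>L T)"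

lemma laurent_scale: "laurent U q T \<Longrightarrow> laurent U (\<lambda>z. c * q z) (c *\<^sub>C T)"
proof -
  assume "laurent U q T"
  moreover have "(c *\<^sub>C id_blinfun) o\<^sub>L T = c *\<^sub>C T"
    by (rule blinfun_eqI) (simp add: scaleC_blinfun.rep_eq)
  ultimately show ?thesis using laurent_mult[OF laurent_const] by metis
qed

lemma laurent_diff: "laurent U q S \<Longrightarrow> laurent U r T \<Longrightarrow> laurent U (\<lambda>z. q z - r z) (S - T)"
  using laurent_add[OF _ laurent_scale[of U r T "-1"], of q S] by simp

context
  fixes U :: "'h::chilbert_space \<Rightarrow>\<^sub>L 'h"
  assumes U: "unitary U"
begin

lemma laurent_BH: "laurent U q T \<Longrightarrow> T \<in> BH"
  by (induction rule: laurent.induct)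
    (auto intro: BH_add BH_compose BH_cscale unitary_BH[OF U] unitary_adj_BH[OF U])

lemma laurent_adj: "laurent U q T \<Longrightarrow> laurent U (\<lambda>z. cnj (q z)) (adj T)"
proof (induction rule: laurent.induct)
  case (laurent_const c)
  then show ?case using laurent.laurent_const[of U "cnj c"] by (simp add: adj_scaleC)
next
  case (laurent_mult q S r T)
  then show ?case using laurent.laurent_mult[OF laurent_mult.IH(2,1)]
    by (simp add: adj_compose laurent_BH mult.commute)
qed (auto simp: adj_adj adj_add unitary_BH[OF U] laurent_BH intro: laurent.intros)

text \<open>The constant does not depend on the vector, so approximate eigenvectors of
  \<open>U\<close> serve all Laurent polynomials in \<open>U\<close> simultaneously. For products, S
  T x - q r x splits into S (T x - r x) + r (S x - q x).\<close>

lemma laurent_approximate_eigenvector: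
  assumes "laurent U q T" "cmod z = 1"
  shows "\<exists>C\<ge>0. \<forall>x. norm (T x - q z *\<^sub>C x) \<le> C * norm (U x - z *\<^sub>C x)"
  using assms(1)
proof (induction rule: laurent.induct)
  case (laurent_const c)
  then show ?case by (intro exI[of _ 0]) (simp add: scaleC_blinfun.rep_eq)
next
  case laurent_gen
  then show ?case by (intro exI[of _ 1]) simp
next
  case laurent_cnj
  have "norm (adj U x - cnj z *\<^sub>C x) = norm (U x - z *\<^sub>C x)" for x
  proof -
    have "norm (adj U x - cnj z *\<^sub>C x) = norm (z *\<^sub>C U (adj U x - cnj z *\<^sub>C x))"
      using assms by (simp add: norm_scaleC U)
    also have "z *\<^sub>C U (adj U x - cnj z *\<^sub>C x) = z *\<^sub>C x - U x"
      using assms complex_norm_square[of z]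
      by (simp add: blinfun.diff_right U BH_scaleC[OF unitary_BH[OF U]] scaleC_scaleC scaleC_one
          complex_vector.scale_right_diff_distrib)
    finally show ?thesis by (simp add: norm_minus_commute)
  qed
  then show ?case by (intro exI[of _ 1]) simp
next
  case (laurent_add q S r T)
  then obtain C D where CD: "C \<ge> 0" "\<And>x. norm (S x - q z *\<^sub>C x) \<le> C * norm (U x - z *\<^sub>C x)"
      "D \<ge> 0" "\<And>x. norm (T x - r z *\<^sub>C x) \<le> D * norm (U x - z *\<^sub>C x)" by blast
  have "norm ((S + T) x - (q z + r z) *\<^sub>C x) \<le> (C + D) * norm (U x - z *\<^sub>C x)" for x
  proof -
    have "(S + T) x - (q z + r z) *\<^sub>C x = (S x - q z *\<^sub>C x) + (T x - r z *\<^sub>C x)"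
      by (simp add: blinfun.add_left scaleC_add_left)
    then show ?thesis
      using norm_triangle_mono[OF CD(2)[of x] CD(4)[of x]] by (simp add: distrib_right)
  qed
  then show ?case using CD by (intro exI[of _ "C + D"]) auto
next
  case (laurent_mult q S r T)
  then obtain C D where CD: "C \<ge> 0" "\<And>x. norm (S x - q z *\<^sub>C x) \<le> C * norm (U x - z *\<^sub>C x)"
      "D \<ge> 0" "\<And>x. norm (T x - r z *\<^sub>C x) \<le> D * norm (U x - z *\<^sub>C x)" by blast
  have "norm ((S o\<^sub>L T) x - (q z * r z) *\<^sub>C x) \<le> (norm S * D + cmod (r z) * C) * norm (U x - z *\<^sub>C x)" for x
  proof -
    have "(S o\<^sub>L T) x - (q z * r z) *\<^sub>C x = S (T x - r z *\<^sub>C x) + r z *\<^sub>C (S x - q z *\<^sub>C x)"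
      using BH_scaleC[OF laurent_BH[OF laurent_mult.hyps(1)]]
      by (simp add: blinfun.diff_right complex_vector.scale_right_diff_distrib scaleC_scaleC mult.commute)
    moreover have "norm (S (T x - r z *\<^sub>C x)) \<le> norm S * (D * norm (U x - z *\<^sub>C x))"
      by (rule order_trans[OF norm_blinfun mult_left_mono[OF CD(4)]]) simp
    moreover have "norm (r z *\<^sub>C (S x - q z *\<^sub>C x)) \<le> cmod (r z) * (C * norm (U x - z *\<^sub>C x))"
      unfolding norm_scaleC by (rule mult_left_mono[OF CD(2)]) simp
    ultimately show ?thesis
      using norm_triangle_mono by (fastforce simp: algebra_simps)
  qed
  then show ?case using CD by (intro exI[of _ "norm S * D + cmod (r z) * C"]) auto
qed

text \<open>Clearing denominators, since \<open>cnj\<close> z = 1 / z on the circle. The same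
  exponent and polynomial must serve the operator and the function, which is why both conjuncts go
  through a single induction.\<close>

lemma laurent_polynomial:
  assumes "laurent U q T"
  shows "\<exists>N A. (\<forall>x. poly_op U (monom 1 N) (T x) = poly_op U A x) \<and>
    (\<forall>z. cmod z = 1 \<longrightarrow> z ^ N * q z = poly A z)"
  using assms
proof (induction rule: laurent.induct)
  case (laurent_const c)
  then show ?case
    by (intro exI[of _ 0] exI[of _ "[:c:]"])
      (simp add: scaleC_blinfun.rep_eq blinfun.zero_left blinfun.zero_right)
next
  case laurent_gen
  then show ?case
    by (intro exI[of _ 0] exI[of _ "[:0, 1:]"])
      (simp add: blinfun.zero_left blinfun.zero_right scaleC_one)
next
  case laurent_cnj
  then show ?case
    by (intro exI[of _ 1] exI[of _ 1])
      (auto simp: monom_Suc U blinfun.zero_left blinfun.zero_right simp flip: complex_norm_square)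
next
  case (laurent_add q S r T)
  then obtain N A M B where *:
    "\<And>x. poly_op U (monom 1 N) (S x) = poly_op U A x" "\<And>z. cmod z = 1 \<Longrightarrow> z ^ N * q z = poly A z"
    "\<And>x. poly_op U (monom 1 M) (T x) = poly_op U B x" "\<And>z. cmod z = 1 \<Longrightarrow> z ^ M * r z = poly B z"
    by blast
  have m: "monom 1 (N + M) = monom 1 M * monom (1::complex) N" "monom 1 (N + M) = monom 1 N * monom (1::complex) M"
    by (simp_all add: mult_monom add.commute)
  show ?case
  proof (intro exI conjI allI impI)
    fix x
    have "poly_op U (monom 1 (N + M)) (S x) = poly_op U (monom 1 M * A) x"
      unfolding m(1) by (simp add: poly_op_mult unitary_BH[OF U] *)
    moreover have "poly_op U (monom 1 (N + M)) (T x) = poly_op U (monom 1 N * B) x"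
      unfolding m(2) by (simp add: poly_op_mult unitary_BH[OF U] *)
    ultimately show "poly_op U (monom 1 (N + M)) ((S + T) x) = poly_op U (monom 1 M * A + monom 1 N * B) x"
      by (simp add: poly_op_add blinfun.add_left blinfun.add_right)
  next
    fix z :: complex assume "cmod z = 1"
    then show "z ^ (N + M) * (q z + r z) = poly (monom 1 M * A + monom 1 N * B) z"
      by (simp add: poly_monom power_add algebra_simps flip: *)
  qed
next
  case (laurent_mult q S r T)
  then obtain N A M B where *:
    "\<And>x. poly_op U (monom 1 N) (S x) = poly_op U A x" "\<And>z. cmod z = 1 \<Longrightarrow> z ^ N * q z = poly A z"
    "\<And>x. poly_op U (monom 1 M) (T x) = poly_op U B x" "\<And>z. cmod z = 1 \<Longrightarrow> z ^ M * r z = poly B z"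
    by blast
  have m: "monom 1 (N + M) = monom 1 M * monom (1::complex) N"
    by (simp add: mult_monom add.commute)
  show ?case
  proof (intro exI conjI allI impI)
    fix x
    have "poly_op U (monom 1 (N + M)) (S (T x)) = poly_op U (monom 1 M) (poly_op U A (T x))"
      unfolding m by (simp add: poly_op_mult unitary_BH[OF U] *)
    also have "\<dots> = poly_op U A (poly_op U B x)"
      \<comment> \<open>The power that clears \<open>T\<close> has to move past the polynomial
        \<open>A\<close> before it meets \<open>T\<close>.\<close>
      using poly_op_commute[OF unitary_BH[OF U], of "monom 1 M" A "T x"] by (simp add: *)
    also have "\<dots> = poly_op U (A * B) x"
      by (simp add: poly_op_mult unitary_BH[OF U])
    finally show "poly_op U (monom 1 (N + M)) ((S o\<^sub>L T) x) = poly_op U (A * B) x" by simp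
  next
    fix z :: complex assume "cmod z = 1"
    then show "z ^ (N + M) * (q z * r z) = poly (A * B) z"
      by (simp add: power_add algebra_simps flip: *)
  qed
qed

end

section \<open>Positivity of matrices over the Laurent polynomials in a unitary\<close>

text \<open>\<open>m\<close> is the infimum of the form on the unit sphere, so \<open>c\<close> =
  form - m * norm^2 is nonnegative. Perturbing h in the direction of its own residual X h - m h and
  using \<open>c\<close> \<ge> 0 bounds the squared residual by a multiple of \<open>c h\<close>;
  near-minimisers are therefore approximate eigenvectors.\<close>

lemma hermitian_form_approximate_eigenvector:
  fixes X :: "nat \<Rightarrow> nat \<Rightarrow> ('h::chilbert_space \<Rightarrow>\<^sub>L 'h)" and h0 :: "nat \<Rightarrow> 'h"
  assumes herm: "\<And>i j x y. i < n \<Longrightarrow> j < n \<Longrightarrow> cinner (X i j x) y = cinner x (X j i y)"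
    and neg: "Re (\<Sum>i<n. \<Sum>j<n. cinner (X i j (h0 j)) (h0 i)) < 0"
  shows "\<exists>m<0. \<forall>e>0. \<exists>h. (\<Sum>i<n. (norm (h i))\<^sup>2) = 1 \<and>
    (\<forall>i<n. norm ((\<Sum>j<n. X i j (h j)) - m *\<^sub>R h i) < e)"
proof -
  define B where "B h k = (\<Sum>i<n. \<Sum>j<n. cinner (X i j (h j)) (k i))" for h k :: "nat \<Rightarrow> 'h"
  define b where "b h = Re (B h h)" for h
  define N where "N h = (\<Sum>i<n. (norm (h i))\<^sup>2)" for h :: "nat \<Rightarrow> 'h"
  define C where "C = (\<Sum>i<n. \<Sum>j<n. norm (X i j))"
  have N0: "N h \<ge> 0" for h by (simp add: N_def sum_nonneg)
  have N_le: "(norm (h i))\<^sup>2 \<le> N h" if "i < n" for h i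
    unfolding N_def by (rule member_le_sum) (use that in auto)
  have b_bound: "\<bar>b h\<bar> \<le> C * N h" for h
  proof -
    have "cmod (cinner (X i j (h j)) (h i)) \<le> norm (X i j) * N h" if "i < n" "j < n" for i j
    proof -
      have "norm (h j) * norm (h i) \<le> sqrt (N h) * sqrt (N h)"
        by (intro mult_mono real_le_rsqrt N_le that) (use N0 in auto)
      then have "norm (h j) * norm (h i) \<le> N h" using N0 by simp
      moreover have "cmod (cinner (X i j (h j)) (h i)) \<le> (norm (X i j) * norm (h j)) * norm (h i)"
        by (rule order_trans[OF cinner_Cauchy_Schwarz]) (intro mult_right_mono norm_blinfun norm_ge_zero)
      ultimately show ?thesis
        by (metis (no_types, opaque_lifting) mult.assoc mult_left_mono norm_ge_zero order_trans)
    qed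
    then have "cmod (B h h) \<le> (\<Sum>i<n. \<Sum>j<n. norm (X i j) * N h)"
      unfolding B_def by (intro order_trans[OF norm_sum] sum_mono) auto
    then show ?thesis
      using abs_Re_le_cmod[of "B h h"] by (simp add: b_def C_def sum_distrib_right)
  qed
  have b_scale: "b (\<lambda>i. r *\<^sub>R h i) = r\<^sup>2 * b h" for r h
    unfolding b_def B_def
    by (simp add: blinfun.scaleR_right cinner.scaleR_left cinner.scaleR_right sum_distrib_left
        power2_eq_square mult.assoc flip: scaleR_right.sum)
  have N_scale: "N (\<lambda>i. r *\<^sub>R h i) = r\<^sup>2 * N h" for r h
    unfolding N_def by (simp add: power_mult_distrib sum_distrib_left)
  have normalise: "\<exists>r>0. N (\<lambda>i. r *\<^sub>R h i) = 1 \<and> b h = N h * b (\<lambda>i. r *\<^sub>R h i)" if "N h > 0" for h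
  proof (intro exI conjI)
    show "N (\<lambda>i. (1 / sqrt (N h)) *\<^sub>R h i) = 1" "b h = N h * b (\<lambda>i. (1 / sqrt (N h)) *\<^sub>R h i)"
      using that by (simp_all add: N_scale b_scale power_divide)
  qed (use that in simp)
  define S where "S = {b h |h. N h = 1}"
  define m where "m = Inf S"
  have bdd: "bdd_below S"
  proof (rule bdd_belowI)
    fix y assume "y \<in> S"
    then obtain h where "y = b h" "N h = 1" by (auto simp: S_def)
    then show "- C \<le> y" using b_bound[of h] by (simp add: abs_le_iff)
  qed
  have m_le: "m * N h \<le> b h" for h
  proof (cases "N h = 0")
    case True
    then show ?thesis using b_bound[of h] by simp
  next
    case False
    then have pos: "N h > 0" using N0[of h] by simp
    then obtain r where r: "r > 0" "N (\<lambda>i. r *\<^sub>R h i) = 1" "b h = N h * b (\<lambda>i. r *\<^sub>R h i)"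
      using normalise by blast
    then have "b (\<lambda>i. r *\<^sub>R h i) \<in> S" by (auto simp: S_def)
    then have "m \<le> b (\<lambda>i. r *\<^sub>R h i)" unfolding m_def using bdd by (rule cInf_lower)
    then show ?thesis using r pos by (simp add: mult.commute)
  qed
  have b0: "b h0 < 0" using neg by (simp add: b_def B_def)
  then have N0pos: "N h0 > 0" using b_bound[of h0] N0[of h0] by (cases "N h0 = 0") auto
  have m0: "m < 0"
  proof -
    have "m * N h0 < 0" using m_le[of h0] b0 by simp
    then show ?thesis using N0pos by (simp add: mult_less_0_iff)
  qed
  have S_ne: "S \<noteq> {}" using normalise[OF N0pos] by (auto simp: S_def)
  define c where "c h = b h - m * N h" for h
  \<comment> \<open>Chosen so that \<open>c h \<le> D * N h\<close>; the summand 1 makes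
    \<open>D\<close> strictly positive.\<close>
  define D where "D = C + \<bar>m\<bar> + 1"
  have C0: "C \<ge> 0" by (simp add: C_def sum_nonneg)
  have D: "D > 0" using C0 by (simp add: D_def)
  have c0: "c h \<ge> 0" for h using m_le[of h] by (simp add: c_def)
  have c_bound: "c h \<le> D * N h" for h
  proof -
    have "- m * N h \<le> \<bar>m\<bar> * N h" using N0[of h] by (intro mult_right_mono) auto
    then have "c h \<le> C * N h + \<bar>m\<bar> * N h + N h" using b_bound[of h] N0[of h] by (simp add: c_def abs_le_iff)
    then show ?thesis by (simp add: D_def algebra_simps)
  qed
  define Y where "Y h i = (\<Sum>j<n. X i j (h j)) - m *\<^sub>R h i" for h i
  have Y_bound: "N (Y h) \<le> D * c h" for h
  proof -
    let ?k = "Y h"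
    have sym: "B ?k h = cnj (B h ?k)"
    proof -
      have "B ?k h = (\<Sum>i<n. \<Sum>j<n. cinner (?k j) (X j i (h i)))"
        unfolding B_def by (intro sum.cong refl) (simp add: herm)
      also have "\<dots> = (\<Sum>i<n. \<Sum>j<n. cnj (cinner (X j i (h i)) (?k j)))"
        by (intro sum.cong refl) (rule cinner_commute)
      also have "\<dots> = cnj (B h ?k)" unfolding B_def cnj_sum by (rule sum.swap)
      finally show ?thesis .
    qed
    \<comment> \<open>The residual paired with itself, expanded only in its first argument; this
      gives \<open>p - m * q = N ?k\<close>, the coefficient of the linear term below.\<close>
    have Bk: "B h ?k - m *\<^sub>R (\<Sum>i<n. cinner (h i) (?k i)) = of_real (N ?k)"
    proof -
      have "of_real (N ?k) = (\<Sum>i<n. cinner (?k i) (?k i))"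
        unfolding N_def of_real_sum by (intro sum.cong refl) (simp only: cinner_self)
      also have "\<dots> = (\<Sum>i<n. (\<Sum>j<n. cinner (X i j (h j)) (?k i)) - m *\<^sub>R cinner (h i) (?k i))"
        by (intro sum.cong refl)
          (subst (1) Y_def, simp add: cinner.diff_left cinner.scaleR_left cinner.sum_left)
      finally show ?thesis by (simp add: B_def sum_subtractf scaleR_right.sum)
    qed
    define p where "p = Re (B h ?k)"
    define q where "q = (\<Sum>i<n. Re (cinner (h i) (?k i)))"
    have pq: "p - m * q = N ?k"
      using arg_cong[OF Bk, of Re] by (simp add: p_def q_def Re_sum)
    \<comment> \<open>Minimises the upper bound c h + 2 t N + t^2 D N, which then equals c h - N /
      D.\<close>
    define t where "t = - (1 / D)"
    let ?g = "\<lambda>i. h i + t *\<^sub>R ?k i"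
    have bg: "b ?g = b h + 2 * t * p + t\<^sup>2 * b ?k"
    proof -
      have "B ?g ?g = B h h + t *\<^sub>R (B h ?k + B ?k h) + t\<^sup>2 *\<^sub>R B ?k ?k"
        unfolding B_def
        by (simp add: blinfun.add_right blinfun.scaleR_right cinner_add_left cinner_add_right
            cinner.scaleR_left cinner.scaleR_right sum.distrib scaleR_right.sum scaleR_add_right
            power2_eq_square algebra_simps)
      then show ?thesis by (simp add: sym b_def p_def)
    qed
    have Ng: "N ?g = N h + 2 * t * q + t\<^sup>2 * N ?k"
      unfolding N_def q_def
      by (simp add: norm_add_sq cinner.scaleR_right sum.distrib sum_distrib_left power_mult_distrib
          mult.assoc mult.left_commute)
    have "0 \<le> c ?g" by (rule c0)
    also have "c ?g = c h + 2 * t * (p - m * q) + t\<^sup>2 * c ?k"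
      unfolding c_def bg Ng by (simp add: algebra_simps)
    also have "\<dots> \<le> c h + 2 * t * N ?k + t\<^sup>2 * (D * N ?k)"
      unfolding pq by (intro add_left_mono mult_left_mono c_bound) auto
    also have "\<dots> = c h - N ?k / D"
      using D by (simp add: t_def power2_eq_square field_simps)
    finally show ?thesis using D by (simp add: field_simps)
  qed
  show ?thesis
  proof (intro exI[of _ m] conjI allI impI m0)
    fix e :: real assume e: "e > 0"
    have "Inf S < m + e\<^sup>2 / D" using e D by (simp add: m_def)
    then obtain h where h: "N h = 1" "b h < m + e\<^sup>2 / D"
      using cInf_lessD[OF S_ne] unfolding S_def by blast
    have "c h < e\<^sup>2 / D" using h by (simp add: c_def)
    then have "D * c h < e\<^sup>2" using D by (simp add: field_simps)
    then have Ne: "N (Y h) < e\<^sup>2" using Y_bound[of h] by simp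
    have "norm (Y h i) < e" if "i < n" for i
      using N_le[OF that, of "Y h"] Ne e power_less_imp_less_base[of "norm (Y h i)" 2 e] by simp
    then show "\<exists>h. (\<Sum>i<n. (norm (h i))\<^sup>2) = 1 \<and>
        (\<forall>i<n. norm ((\<Sum>j<n. X i j (h j)) - m *\<^sub>R h i) < e)"
      using h(1) unfolding N_def Y_def by blast
  qed
qed

text \<open>Multiplying by the adjugate matrix reduces a matrix over the commutative ring of
  polynomials in T to its determinant.\<close>

lemma det_poly_op_not_bounded_below:
  fixes T :: "'h::chilbert_space \<Rightarrow>\<^sub>L 'h" and A :: "complex poly mat"
  assumes T: "T \<in> BH" and A: "A \<in> carrier_mat n n"
    and approx: "\<And>e. e > 0 \<Longrightarrow> \<exists>h. (\<Sum>i<n. (norm (h i))\<^sup>2) = 1 \<and>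
      (\<forall>i<n. norm (\<Sum>j<n. poly_op T (A $$ (i, j)) (h j)) < e)"
  shows "\<not> bounded_below (poly_op T (Determinant.det A))"
proof
  assume "bounded_below (poly_op T (Determinant.det A))"
  then obtain d where d: "d > 0" "\<And>x. d * norm x \<le> norm (poly_op T (Determinant.det A) x)"
    by (auto simp: bounded_below_def)
  let ?J = "adj_mat A"
  define K where "K = (\<Sum>k<n. \<Sum>i<n. norm (poly_op T (?J $$ (k, i))))"
  have K0: "K \<ge> 0" by (simp add: K_def sum_nonneg)
  \<comment> \<open>Small enough that every component of \<open>h\<close> has norm at most 1 / (n +
    1). The squares then sum to at most n / (n + 1)^2 < 1, against the normalisation.\<close>
  define e where "e = d / ((K + 1) * (real n + 1))"
  have e: "e > 0" using d K0 by (simp add: e_def)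
  obtain h where h: "(\<Sum>i<n. (norm (h i))\<^sup>2) = 1"
    "\<And>i. i < n \<Longrightarrow> norm (\<Sum>j<n. poly_op T (A $$ (i, j)) (h j)) < e"
    using approx[OF e] by blast
  have "norm (h k) \<le> 1 / (real n + 1)" if k: "k < n" for k
  proof -
    let ?g = "\<lambda>i. \<Sum>j<n. poly_op T (A $$ (i, j)) (h j)"
    have entry: "(\<Sum>i<n. ?J $$ (k, i) * A $$ (i, j)) = (if k = j then Determinant.det A else 0)"
      if j: "j < n" for j
    proof -
      have "(?J * A) $$ (k, j) = (\<Sum>i<n. ?J $$ (k, i) * A $$ (i, j))"
        using A adj_mat(1)[OF A] k j by (simp add: scalar_prod_def lessThan_atLeast0)
      moreover have "(?J * A) $$ (k, j) = (if k = j then Determinant.det A else 0)"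
        unfolding adj_mat(3)[OF A] using k j by simp
      ultimately show ?thesis by simp
    qed
    have "(\<Sum>i<n. poly_op T (?J $$ (k, i)) (?g i)) =
        (\<Sum>i<n. \<Sum>j<n. poly_op T (?J $$ (k, i) * A $$ (i, j)) (h j))"
      by (simp add: blinfun.sum_right poly_op_mult[OF T])
    also have "\<dots> = (\<Sum>j<n. poly_op T (\<Sum>i<n. ?J $$ (k, i) * A $$ (i, j)) (h j))"
      unfolding poly_op_sum[OF T] by (rule sum.swap)
    also have "\<dots> = (\<Sum>j<n. if k = j then poly_op T (Determinant.det A) (h j) else 0)"
      by (intro sum.cong refl) (auto simp: entry blinfun.zero_left)
    also have "\<dots> = poly_op T (Determinant.det A) (h k)" using k by simp
    finally have "d * norm (h k) \<le> norm (\<Sum>i<n. poly_op T (?J $$ (k, i)) (?g i))"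
      using d(2)[of "h k"] by simp
    also have "\<dots> \<le> (\<Sum>i<n. norm (poly_op T (?J $$ (k, i))) * e)"
    proof (rule order_trans[OF norm_sum sum_mono])
      fix i assume "i \<in> {..<n}"
      then show "norm (poly_op T (?J $$ (k, i)) (?g i)) \<le> norm (poly_op T (?J $$ (k, i))) * e"
        using h(2)[of i] by (intro order_trans[OF norm_blinfun mult_left_mono]) auto
    qed
    also have "\<dots> \<le> K * e"
    proof -
      have "(\<Sum>i<n. norm (poly_op T (?J $$ (k, i)))) \<le> K"
        unfolding K_def by (rule member_le_sum[where f = "\<lambda>k. \<Sum>i<n. norm (poly_op T (?J $$ (k, i)))"])
          (use k in \<open>auto simp: sum_nonneg\<close>)
      then show ?thesis using e by (simp add: mult_right_mono flip: sum_distrib_right)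
    qed
    also have "\<dots> \<le> (K + 1) * e" using e by simp
    also have "\<dots> = d * (1 / (real n + 1))" using K0 by (simp add: e_def)
    finally show ?thesis using d(1) by (simp only: mult_le_cancel_left_pos)
  qed
  then have "(\<Sum>i<n. (norm (h i))\<^sup>2) \<le> (\<Sum>i<n. (1 / (real n + 1))\<^sup>2)"
    by (intro sum_mono power_mono) auto
  also have "\<dots> = real n / (real n + 1)\<^sup>2" by (simp add: power_divide)
  also have "\<dots> < 1"
  proof -
    have "(real n + 1)\<^sup>2 = (real n)\<^sup>2 + 2 * real n + 1" by (simp add: power2_sum)
    then have "real n < (real n + 1)\<^sup>2" using zero_le_power2[of "real n"] by linarith
    then show ?thesis by simp
  qed
  finally show False using h(1) by simp
qed

text \<open>Polarisation: realness of the form on e_k + c e_l for c = 1 and c = i compares the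
  imaginary and the real parts of the two entries.\<close>

lemma positive_form_hermitian:
  fixes a :: "nat \<Rightarrow> nat \<Rightarrow> complex"
  assumes pos: "\<And>v. (\<Sum>i<n. \<Sum>j<n. a i j * v j * cnj (v i)) \<in> \<real>\<^sub>\<ge>\<^sub>0" and kl: "k < n" "l < n"
  shows "cnj (a k l) = a l k"
proof -
  define Q where "Q v w = (\<Sum>i<n. \<Sum>j<n. a i j * v j * cnj (w i))" for v w
  define E where "E k = (\<lambda>j::nat. if j = k then 1 else 0 :: complex)" for k
  have QE: "Q (E l) (E k) = a k l" if "k < n" "l < n" for k l
  proof -
    have "(\<Sum>j<n. a i j * E l j * cnj (E k i)) = (if i = k then a i l else 0)" for i
      using that by (simp add: E_def if_distrib[of "\<lambda>x. _ * x"] cong: if_cong)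
    then show ?thesis using that by (simp add: Q_def)
  qed
  have real: "Im (Q v v) = 0" for v
    using pos[of v] by (simp add: Q_def complex_nonneg_Reals_iff)
  have exp: "Q (\<lambda>j. v j + c * w j) (\<lambda>j. v j + c * w j) = Q v v + c * Q w v + cnj c * Q v w + c * cnj c * Q w w" for v w c
    unfolding Q_def by (simp add: algebra_simps sum.distrib sum_distrib_left)
  have *: "Im (c * a k l + cnj c * a l k) = 0" for c
    using real[of "\<lambda>j. E k j + c * E l j"] real[of "E k"] real[of "E l"]
    unfolding exp[of "E k" c "E l"] QE[OF kl] QE[OF kl(2,1)] QE[OF kl(1,1)] QE[OF kl(2,2)]
    by (simp add: algebra_simps)
  show ?thesis using *[of 1] *[of \<i>] by (simp add: complex_eq_iff)
qed

context
  fixes U :: "'h::chilbert_space \<Rightarrow>\<^sub>L 'h"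
  assumes U: "unitary U"
begin

lemma norm_poly_op_monom: "norm (poly_op U (monom 1 N) x) = norm x"
  by (induction N arbitrary: x) (simp_all add: monom_Suc U blinfun.zero_left blinfun.zero_right scaleC_one)

lemma spectrum_root:
  assumes "p \<noteq> 0" "\<not> bounded_below (poly_op U p)"
  shows "\<exists>r\<in>spectrum U. poly p r = 0"
proof -
  obtain r where "poly p r = 0" "\<not> bounded_below (U - r *\<^sub>C id_blinfun)"
    using bounded_below_poly_op[OF unitary_BH[OF U], of p] assms by blast
  then show ?thesis using spectrum_iff_not_bounded_below[OF U, of r] by auto
qed

text \<open>The infimum argument for the 1-by-1 matrix U + \<open>adj U\<close> - 5: after
  multiplication by \<open>U\<close>, the shifted operator is a monic quadratic in \<open>U\<close>,
  so some root lies in the spectrum. The result is needed for determinants that vanish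
  identically.\<close>

lemma spectrum_nonempty:
  assumes x: "(x :: 'h) \<noteq> 0" shows "spectrum U \<noteq> {}"
proof -
  \<comment> \<open>Any constant above 2 makes the form negative, since U + \<open>adj U\<close>
    contributes at most 2 |x|^2; here the form is at most - 3 |x|^2.\<close>
  define X where "X = U + adj U - (5::complex) *\<^sub>C id_blinfun"
  have X: "X u = U u + adj U u - 5 *\<^sub>C u" for u
    by (simp add: X_def blinfun.diff_left blinfun.add_left scaleC_blinfun.rep_eq)
  have herm: "cinner (X u) v = cinner u (X v)" for u v
    by (simp add: X cinner.diff_left cinner.diff_right cinner_add_left cinner_add_right
        cinner_scaleC_left cinner_scaleC_right cinner_adj[OF unitary_BH[OF U]] cinner_adj'[OF unitary_BH[OF U]])
  have "Re (cinner (X x) x) < 0"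
  proof -
    have "Re (cinner (U x) x) \<le> (norm x)\<^sup>2" "Re (cinner (adj U x) x) \<le> (norm x)\<^sup>2"
      using order_trans[OF complex_Re_le_cmod cinner_Cauchy_Schwarz, of "U x" x]
        order_trans[OF complex_Re_le_cmod cinner_Cauchy_Schwarz, of "adj U x" x]
      by (simp_all add: U power2_eq_square)
    moreover have "(norm x)\<^sup>2 > 0" using x by simp
    moreover have "Re (cinner (X x) x) = Re (cinner (U x) x) + Re (cinner (adj U x) x) - 5 * (norm x)\<^sup>2"
      by (simp add: X cinner.diff_left cinner_add_left cinner_scaleC_left cinner_self_Re)
    ultimately show ?thesis by linarith
  qed
  then have neg: "Re (\<Sum>i<(1::nat). \<Sum>j<(1::nat). cinner (X x) x) < 0" by simp
  have "\<exists>m<0. \<forall>e>0. \<exists>h. (\<Sum>i<(1::nat). (norm (h i))\<^sup>2) = 1 \<and>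
      (\<forall>i<1. norm ((\<Sum>j<(1::nat). X (h j)) - m *\<^sub>R h i) < e)"
    by (rule hermitian_form_approximate_eigenvector[where X = "\<lambda>_ _. X", OF herm neg])
  then obtain m where m: "\<And>e. e > 0 \<Longrightarrow> \<exists>h::nat \<Rightarrow> 'h. (norm (h 0))\<^sup>2 = 1 \<and> norm (X (h 0) - m *\<^sub>R h 0) < e"
    by auto
  define p :: "complex poly" where "p = [:1, - 5 - of_real m, 1:]"
  have "\<not> bounded_below (poly_op U p)"
  proof
    assume "bounded_below (poly_op U p)"
    then obtain d where d: "d > 0" "\<And>u. d * norm u \<le> norm (poly_op U p u)"
      by (auto simp: bounded_below_def)
    obtain h :: "nat \<Rightarrow> 'h" where "(norm (h 0))\<^sup>2 = 1" and h2: "norm (X (h 0) - m *\<^sub>R h 0) < d"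
      using m[OF d(1)] by blast
    then have h: "norm (h 0) = 1" by (metis norm_ge_zero real_sqrt_one real_sqrt_unique)
    have "poly_op U p (h 0) = U (X (h 0) - m *\<^sub>R h 0)"
      by (simp add: p_def X blinfun.zero_left blinfun.zero_right blinfun.diff_right blinfun.add_right U
          scaleC_one scaleR_scaleC BH_scaleC[OF unitary_BH[OF U]] algebra_simps
          complex_vector.scale_left_diff_distrib)
    then show False using d(2)[of "h 0"] h h2 by (simp add: U)
  qed
  then show ?thesis using spectrum_root[of p] by (auto simp: p_def)
qed

text \<open>Self-adjointness makes the form real-valued, so failure of positivity means a negative
  value and the infimum argument applies. In \<open>laurent_matrix_positive_iff\<close> this
  hypothesis is derived from pointwise positivity.\<close>

lemma laurent_matrix_positive_hermitian:
  assumes L: "\<And>i j. i < n \<Longrightarrow> j < n \<Longrightarrow> laurent U (q i j) (X i j)"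
    and herm: "\<And>i j. i < n \<Longrightarrow> j < n \<Longrightarrow> adj (X i j) = X j i"
    and pos: "\<And>z v. z \<in> spectrum U \<Longrightarrow> (\<Sum>i<n. \<Sum>j<n. q i j z * v j * cnj (v i)) \<in> \<real>\<^sub>\<ge>\<^sub>0"
  shows "matrix_positive n X"
proof (rule ccontr)
  assume "\<not> matrix_positive n X"
  then obtain h0 :: "nat \<Rightarrow> 'h" where
    h0: "(\<Sum>i<n. \<Sum>j<n. cinner (X i j (h0 j)) (h0 i)) \<notin> \<real>\<^sub>\<ge>\<^sub>0" (is "?s \<notin> _")
    by (auto simp: matrix_positive_def)
  have herm': "cinner (X i j x) y = cinner x (X j i y)" if "i < n" "j < n" for i j x y
    using cinner_adj[OF laurent_BH[OF U L[OF that]]] herm[OF that] by simp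
  have "cnj ?s = (\<Sum>i<n. \<Sum>j<n. cinner (X j i (h0 i)) (h0 j))"
    unfolding cnj_sum
  proof (intro sum.cong refl)
    fix i j assume "i \<in> {..<n}" "j \<in> {..<n}"
    then have "cinner (X j i (h0 i)) (h0 j) = cinner (h0 i) (X i j (h0 j))" by (simp add: herm')
    then show "cnj (cinner (X i j (h0 j)) (h0 i)) = cinner (X j i (h0 i)) (h0 j)"
      using cinner_commute[of "h0 i" "X i j (h0 j)"] by simp
  qed
  also have "\<dots> = ?s" by (rule sum.swap)
  finally have self: "cnj ?s = ?s" .
  have "Re s < 0" if "cnj s = s" "s \<notin> \<real>\<^sub>\<ge>\<^sub>0" for s
    using that by (auto simp: complex_eq_iff complex_nonneg_Reals_iff)
  from this[OF self h0] have "Re ?s < 0" .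
  from hermitian_form_approximate_eigenvector[of n X, OF herm' this]
  obtain m where m: "m < 0" "\<And>e. e > 0 \<Longrightarrow> \<exists>h. (\<Sum>i<n. (norm (h i))\<^sup>2) = 1 \<and>
    (\<forall>i<n. norm ((\<Sum>j<n. X i j (h j)) - m *\<^sub>R h i) < e)" by blast
  \<comment> \<open>In the zero space no family could satisfy the normalisation, so the spectrum is
    nonempty.\<close>
  have "\<exists>x::'h. x \<noteq> 0"
  proof (rule ccontr)
    assume "\<nexists>x::'h. x \<noteq> 0"
    then have zero: "norm (x :: 'h) = 0" for x by simp
    have sum_zero: "(\<Sum>i<n. (norm (h i :: 'h))\<^sup>2) = 0" for h by (simp only: zero) simp
    obtain h :: "nat \<Rightarrow> 'h" where "(\<Sum>i<n. (norm (h i))\<^sup>2) = 1"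
      using m(2)[of 1] by auto
    then show False unfolding sum_zero by simp
  qed
  then have ne: "spectrum U \<noteq> {}" using spectrum_nonempty by blast
  have "\<forall>i j. \<exists>N A. i < n \<longrightarrow> j < n \<longrightarrow> (\<forall>x. poly_op U (monom 1 N) (X i j x) = poly_op U A x) \<and>
      (\<forall>z. cmod z = 1 \<longrightarrow> z ^ N * q i j z = poly A z)"
    using laurent_polynomial[OF U L] by blast
  then obtain M P where MP: "\<And>i j x. i < n \<Longrightarrow> j < n \<Longrightarrow> poly_op U (monom 1 (M i j)) (X i j x) = poly_op U (P i j) x"
    "\<And>i j z. i < n \<Longrightarrow> j < n \<Longrightarrow> cmod z = 1 \<Longrightarrow> z ^ M i j * q i j z = poly (P i j) z"
    by metis
  \<comment> \<open>A common exponent for all entries; the sum merely dominates each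
    \<open>M i j\<close>.\<close>
  define N where "N = (\<Sum>i<n. \<Sum>j<n. M i j)"
  have MN: "M i j \<le> N" if "i < n" "j < n" for i j
  proof -
    have "M i j \<le> (\<Sum>j<n. M i j)" using that by (intro member_le_sum) auto
    also have "\<dots> \<le> N" unfolding N_def
      using that by (intro member_le_sum[where f = "\<lambda>i. \<Sum>j<n. M i j"]) auto
    finally show ?thesis .
  qed
  \<comment> \<open>Entries of U^N (X - m), now genuine polynomials in \<open>U\<close>.\<close>
  define a where "a i j = monom 1 (N - M i j) * P i j - (if i = j then smult (of_real m) (monom 1 N) else 0)" for i j
  define A where "A = Matrix.mat n n (\<lambda>(i, j). a i j)"
  have A: "A \<in> carrier_mat n n" by (simp add: A_def)
  have a_op: "poly_op U (a i j) x = poly_op U (monom 1 N) (X i j x - (if i = j then m *\<^sub>R x else 0))"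
    if "i < n" "j < n" for i j x
  proof -
    have "monom 1 N = monom 1 (N - M i j) * monom (1::complex) (M i j)"
      using MN[OF that] by (simp add: mult_monom)
    then have "poly_op U (monom 1 N) (X i j x) = poly_op U (monom 1 (N - M i j) * P i j) x"
      by (simp add: poly_op_mult[OF unitary_BH[OF U]] MP that)
    then show ?thesis
      by (simp add: a_def poly_op_diff[OF unitary_BH[OF U]] poly_op_smult[OF unitary_BH[OF U]]
          blinfun.diff_right scaleR_scaleC BH_scaleC[OF poly_op_BH[OF unitary_BH[OF U]]]
          blinfun.zero_left blinfun.zero_right)
  qed
  have "\<not> bounded_below (poly_op U (Determinant.det A))"
  proof (rule det_poly_op_not_bounded_below[OF unitary_BH[OF U] A])
    fix e :: real assume "e > 0"
    then obtain h where h: "(\<Sum>i<n. (norm (h i))\<^sup>2) = 1"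
      "\<And>i. i < n \<Longrightarrow> norm ((\<Sum>j<n. X i j (h j)) - m *\<^sub>R h i) < e" using m(2) by blast
    have "norm (\<Sum>j<n. poly_op U (A $$ (i, j)) (h j)) < e" if i: "i < n" for i
    proof -
      have "(\<Sum>j<n. poly_op U (A $$ (i, j)) (h j)) =
          (\<Sum>j<n. poly_op U (monom 1 N) (X i j (h j) - (if i = j then m *\<^sub>R h j else 0)))"
        using i by (intro sum.cong refl) (simp add: A_def a_op)
      also have "\<dots> = poly_op U (monom 1 N) ((\<Sum>j<n. X i j (h j)) - m *\<^sub>R h i)"
        using i by (simp add: sum_subtractf flip: blinfun.sum_right)
      finally show ?thesis using h(2)[OF i] by (simp add: norm_poly_op_monom)
    qed
    with h show "\<exists>h. (\<Sum>i<n. (norm (h i))\<^sup>2) = 1 \<and>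
        (\<forall>i<n. norm (\<Sum>j<n. poly_op U (A $$ (i, j)) (h j)) < e)" by blast
  qed
  \<comment> \<open>If the determinant is the zero polynomial, any point of the nonempty spectrum is
    a root.\<close>
  then obtain r where r: "r \<in> spectrum U" "poly (Determinant.det A) r = 0"
    using spectrum_root ne by (cases "Determinant.det A = 0") auto
  have r1: "cmod r = 1" using spectrum_norm[OF U r(1)] .
  then have r0: "r \<noteq> 0" by auto
  interpret ev: comm_ring_hom "\<lambda>p. poly p r" by unfold_locales auto
  have "Determinant.det (map_mat (\<lambda>p. poly p r) A) = 0" using r(2) by simp
  then obtain v where v: "v \<in> carrier_vec n" "v \<noteq> 0\<^sub>v n" "map_mat (\<lambda>p. poly p r) A *\<^sub>v v = 0\<^sub>v n"
    using det_0_iff_vec_prod_zero_field[of "map_mat (\<lambda>p. poly p r) A" n] A by auto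
  have eig: "(\<Sum>j<n. q i j r * v $ j) = of_real m * v $ i" if i: "i < n" for i
  proof -
    have "(\<Sum>j<n. poly (a i j) r * v $ j) = (map_mat (\<lambda>p. poly p r) A *\<^sub>v v) $ i"
      using i v(1) by (simp add: A_def scalar_prod_def lessThan_atLeast0)
    also have "\<dots> = 0" using v(3) i by simp
    finally have "(\<Sum>j<n. poly (a i j) r * v $ j) = 0" .
    moreover have "poly (a i j) r = r ^ N * (q i j r - (if i = j then of_real m else 0))" if j: "j < n" for j
    proof -
      have "r ^ N = r ^ (N - M i j) * r ^ M i j" using MN[OF i j] by (simp flip: power_add)
      then show ?thesis by (simp add: a_def poly_monom MP(2)[OF i j r1, symmetric] algebra_simps)
    qed
    ultimately have "r ^ N * (\<Sum>j<n. (q i j r - (if i = j then of_real m else 0)) * v $ j) = 0"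
      by (simp add: sum_distrib_left mult.assoc)
    then have "(\<Sum>j<n. (q i j r - (if i = j then of_real m else 0)) * v $ j) = 0" using r0 by simp
    then show ?thesis using i
      by (simp add: left_diff_distrib sum_subtractf if_distrib[of "\<lambda>x. x * _"] cong: if_cong)
  qed
  \<comment> \<open>Testing the form at the eigenvector gives m |v|^2 \<ge> 0 with m < 0, hence v =
    0.\<close>
  have "(\<Sum>i<n. \<Sum>j<n. q i j r * v $ j * cnj (v $ i)) = (\<Sum>i<n. of_real (m * (cmod (v $ i))\<^sup>2))"
  proof (intro sum.cong refl)
    fix i assume "i \<in> {..<n}"
    then have "(\<Sum>j<n. q i j r * v $ j * cnj (v $ i)) = of_real m * (v $ i * cnj (v $ i))"
      by (simp add: eig mult.assoc[of "of_real m"] flip: sum_distrib_right)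
    then show "(\<Sum>j<n. q i j r * v $ j * cnj (v $ i)) = of_real (m * (cmod (v $ i))\<^sup>2)"
      using complex_norm_square[of "v $ i"] by simp
  qed
  also have "\<dots> = of_real (m * (\<Sum>i<n. (cmod (v $ i))\<^sup>2))" by (simp add: sum_distrib_left)
  finally have "of_real (m * (\<Sum>i<n. (cmod (v $ i))\<^sup>2)) \<in> (\<real>\<^sub>\<ge>\<^sub>0 :: complex set)"
    using pos[OF r(1), of "\<lambda>i. v $ i"] by (simp only:)
  then have "0 \<le> m * (\<Sum>i<n. (cmod (v $ i))\<^sup>2)" by (simp only: nonneg_Reals_of_real_iff)
  then have "(\<Sum>i<n. (cmod (v $ i))\<^sup>2) \<le> 0" using m(1) by (simp add: zero_le_mult_iff)
  then have "\<forall>i<n. v $ i = 0"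
    using sum_nonneg_eq_0_iff[of "{..<n}" "\<lambda>i. (cmod (v $ i))\<^sup>2"] sum_nonneg[of "{..<n}" "\<lambda>i. (cmod (v $ i))\<^sup>2"]
    by auto
  then show False using v(1,2) by (metis eq_vecI carrier_vecD index_zero_vec)
qed

text \<open>The 1-by-1 case of positivity, applied to s^2 - \<open>adj T o\<^sub>L T\<close>, whose
  function s^2 - |q|^2 is nonnegative on the spectrum.\<close>

lemma laurent_norm_le:
  assumes L: "laurent U q T" and s: "s \<ge> 0" and le: "\<And>z. z \<in> spectrum U \<Longrightarrow> cmod (q z) \<le> s"
  shows "norm T \<le> s"
proof -
  define X where "X = of_real (s\<^sup>2) *\<^sub>C id_blinfun - (adj T o\<^sub>L T)"
  define p where "p z = of_real (s\<^sup>2) - cnj (q z) * q z" for z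
  have T: "T \<in> BH" using laurent_BH[OF U L] .
  have "laurent U p X"
    unfolding X_def p_def by (intro laurent_diff laurent_const laurent_mult laurent_adj[OF U] L)
  moreover have "adj X = X"
    by (simp add: X_def adj_diff BH_cscale BH_compose adj_BH T adj_scaleC adj_compose adj_adj)
  moreover have "p z * v * cnj v \<in> \<real>\<^sub>\<ge>\<^sub>0" if "z \<in> spectrum U" for z v
  proof -
    have "p z * v * cnj v = of_real ((s\<^sup>2 - (cmod (q z))\<^sup>2) * (cmod v)\<^sup>2)"
      using complex_norm_square[of v] complex_norm_square[of "q z"]
      by (simp add: p_def mult.assoc mult.commute[of "cnj (q z)"])
    moreover have "(cmod (q z))\<^sup>2 \<le> s\<^sup>2" using le[OF that] by (intro power_mono) auto
    ultimately show ?thesis by (simp only: nonneg_Reals_of_real_iff) simp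
  qed
  ultimately have "matrix_positive 1 (\<lambda>_ _. X)"
    by (intro laurent_matrix_positive_hermitian[where q = "\<lambda>_ _. p"]) auto
  then have "cinner (X x) x \<in> \<real>\<^sub>\<ge>\<^sub>0" for x
    using spec[of _ "\<lambda>_. x"] by (auto simp: matrix_positive_def)
  moreover have "cinner (X x) x = of_real (s\<^sup>2 * (norm x)\<^sup>2 - (norm (T x))\<^sup>2)" for x
    by (simp add: X_def blinfun.diff_left scaleC_blinfun.rep_eq cinner.diff_left cinner_scaleC_left
        cinner_adj'[OF T] cinner_self)
  ultimately have "0 \<le> s\<^sup>2 * (norm x)\<^sup>2 - (norm (T x))\<^sup>2" for x
    by (metis nonneg_Reals_of_real_iff)
  then have "(norm (T x))\<^sup>2 \<le> (s * norm x)\<^sup>2" for x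
    by (simp add: power_mult_distrib)
  then show ?thesis
    using s by (intro norm_blinfun_bound) (auto intro: power2_le_imp_le)
qed

text \<open>The norm bound with s = 0, applied to the difference.\<close>

lemma laurent_eqI:
  assumes "laurent U q S" "laurent U r T" "\<And>z. z \<in> spectrum U \<Longrightarrow> q z = r z"
  shows "S = T"
  using laurent_norm_le[OF laurent_diff[OF assms(1,2)], of 0] assms(3) by simp

text \<open>The form is tested on the vectors v_j x_k, where x_k are approximate eigenvectors of
  \<open>U\<close> for z. In the limit the operators act as the scalars \<open>q i j z\<close>, and
  the nonnegative reals are closed.\<close>

lemma laurent_matrix_positive_pointwise:
  assumes L: "\<And>i j. i < n \<Longrightarrow> j < n \<Longrightarrow> laurent U (q i j) (X i j)"
    and pos: "matrix_positive n X" and z: "z \<in> spectrum U"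
  shows "(\<Sum>i<n. \<Sum>j<n. q i j z * v j * cnj (v i)) \<in> \<real>\<^sub>\<ge>\<^sub>0"
proof -
  have z1: "cmod z = 1" using spectrum_norm[OF U z] .
  have "\<exists>x. norm x = 1 \<and> norm (U x - z *\<^sub>C x) < 1 / real (Suc k)" for k
    using z spectrum_iff_approximate_eigenvalue[OF U] by simp
  then obtain x where x: "\<And>k. norm (x k) = 1" "\<And>k. norm (U (x k) - z *\<^sub>C x k) < 1 / real (Suc k)" by metis
  have lim: "(\<lambda>k. cinner (X i j (x k)) (x k)) \<longlonglongrightarrow> q i j z" if ij: "i < n" "j < n" for i j
  proof -
    obtain C where C: "C \<ge> 0" "\<And>x. norm (X i j x - q i j z *\<^sub>C x) \<le> C * norm (U x - z *\<^sub>C x)"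
      using laurent_approximate_eigenvector[OF U L[OF ij] z1] by blast
    have bound: "norm (cinner (X i j (x k)) (x k) - q i j z) \<le> C * (1 / real (Suc k))" for k
    proof -
      have "cinner (X i j (x k)) (x k) - q i j z = cinner (X i j (x k) - q i j z *\<^sub>C x k) (x k)"
        by (simp add: cinner.diff_left cinner_scaleC_left cinner_self x(1))
      also have "norm \<dots> \<le> norm (X i j (x k) - q i j z *\<^sub>C x k)"
        using cinner_Cauchy_Schwarz[of _ "x k"] by (simp add: x(1))
      also have "\<dots> \<le> C * (1 / real (Suc k))"
        by (rule order_trans[OF C(2) mult_left_mono[OF less_imp_le[OF x(2)] C(1)]])
      finally show ?thesis .
    qed
    have "(\<lambda>k. C * (1 / real (Suc k))) \<longlonglongrightarrow> C * 0"
      by (intro tendsto_intros LIMSEQ_Suc[OF lim_1_over_n])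
    then have "(\<lambda>k. cinner (X i j (x k)) (x k) - q i j z) \<longlonglongrightarrow> 0"
      by (intro Lim_null_comparison[OF always_eventually[OF allI[OF bound]]]) simp
    then show ?thesis by (simp add: LIM_zero_iff)
  qed
  have nonneg: "(\<Sum>i<n. \<Sum>j<n. cinner (X i j (x k)) (x k) * v j * cnj (v i)) \<in> \<real>\<^sub>\<ge>\<^sub>0" for k
  proof -
    have "(\<Sum>i<n. \<Sum>j<n. cinner (X i j (x k)) (x k) * v j * cnj (v i)) =
        (\<Sum>i<n. \<Sum>j<n. cinner (X i j (v j *\<^sub>C x k)) (v i *\<^sub>C x k))"
      by (intro sum.cong refl)
        (simp add: BH_scaleC[OF laurent_BH[OF U L]] cinner_scaleC_left cinner_scaleC_right)
    then show ?thesis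
      using spec[OF pos[unfolded matrix_positive_def], of "\<lambda>j. v j *\<^sub>C x k"] by simp
  qed
  have "(\<lambda>k. \<Sum>i<n. \<Sum>j<n. cinner (X i j (x k)) (x k) * v j * cnj (v i)) \<longlonglongrightarrow>
      (\<Sum>i<n. \<Sum>j<n. q i j z * v j * cnj (v i))"
    by (intro tendsto_sum tendsto_intros lim) auto
  with nonneg show ?thesis by (rule closed_sequentially[OF closed_nonneg_Reals_complex])
qed

text \<open>Pointwise positivity makes the scalar matrices Hermitian at every spectral point, and
  \<open>laurent_eqI\<close> lifts this to \<open>adj (X i j) = X j i\<close>.\<close>

theorem laurent_matrix_positive_iff:
  assumes L: "\<And>i j. i < n \<Longrightarrow> j < n \<Longrightarrow> laurent U (q i j) (X i j)"
  shows "matrix_positive n X \<longleftrightarrow>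
    (\<forall>z\<in>spectrum U. \<forall>v. (\<Sum>i<n. \<Sum>j<n. q i j z * v j * cnj (v i)) \<in> \<real>\<^sub>\<ge>\<^sub>0)"
proof (intro iffI ballI allI)
  assume *: "\<forall>z\<in>spectrum U. \<forall>v. (\<Sum>i<n. \<Sum>j<n. q i j z * v j * cnj (v i)) \<in> \<real>\<^sub>\<ge>\<^sub>0"
  show "matrix_positive n X"
  proof (rule laurent_matrix_positive_hermitian[OF L])
    fix i j assume ij: "i < n" "j < n"
    show "adj (X i j) = X j i"
      by (rule laurent_eqI[OF laurent_adj[OF U L[OF ij]] L[OF ij(2,1)]])
        (use * ij in \<open>auto intro: positive_form_hermitian[where n = n]\<close>)
  qed (use * in auto)
next
  fix z v assume "matrix_positive n X" "z \<in> spectrum U"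
  then show "(\<Sum>i<n. \<Sum>j<n. q i j z * v j * cnj (v i)) \<in> \<real>\<^sub>\<ge>\<^sub>0"
    by (rule laurent_matrix_positive_pointwise[rotated]) (rule L)
qed

end

section \<open>Generated C*-algebras\<close>

text \<open>On an approximate eigenvector T acts nearly as the scalar q z. The accuracy e / (C + 1)
  is safe for C = 0 as well.\<close>

lemma laurent_norm_ge:
  assumes V: "unitary V" and L: "laurent V q T" and z: "z \<in> spectrum V"
  shows "cmod (q z) \<le> norm T"
proof (rule field_le_epsilon)
  fix e :: real assume e: "e > 0"
  obtain C where C: "C \<ge> 0" "\<And>x. norm (T x - q z *\<^sub>C x) \<le> C * norm (V x - z *\<^sub>C x)"
    using laurent_approximate_eigenvector[OF V L spectrum_norm[OF V z]] by blast
  have "e / (C + 1) > 0" using e C(1) by simp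
  then obtain x where x: "norm x = 1" "norm (V x - z *\<^sub>C x) < e / (C + 1)"
    using z spectrum_iff_approximate_eigenvalue[OF V] by blast
  have "cmod (q z) = norm (T x - (T x - q z *\<^sub>C x))" by (simp add: norm_scaleC x(1))
  also have "\<dots> \<le> norm (T x) + norm (T x - q z *\<^sub>C x)" by (rule norm_triangle_ineq4)
  also have "norm (T x) \<le> norm T" using norm_blinfun[of T x] x(1) by simp
  also have "norm (T x - q z *\<^sub>C x) \<le> C * (e / (C + 1))"
    by (rule order_trans[OF C(2) mult_left_mono[OF less_imp_le[OF x(2)] C(1)]])
  also have "\<dots> \<le> e" using C(1) e by (simp add: field_simps)
  finally show "cmod (q z) \<le> norm T + e" by simp
qed

lemma tendsto_scaleC_blinfun:
  fixes T :: "'h::chilbert_space \<Rightarrow>\<^sub>L 'h"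
  assumes "X \<longlonglongrightarrow> T" shows "(\<lambda>n. c *\<^sub>C X n) \<longlonglongrightarrow> c *\<^sub>C T"
proof -
  have eq: "c *\<^sub>C A = (c *\<^sub>C id_blinfun) o\<^sub>L A" for A :: "'h \<Rightarrow>\<^sub>L 'h"
    by (rule blinfun_eqI) (simp add: scaleC_blinfun.rep_eq)
  show ?thesis unfolding eq[of "X _"] eq[of T]
    by (rule bounded_bilinear.tendsto[OF bounded_bilinear_blinfun_compose tendsto_const assms])
qed

text \<open>Supplies completeness of the space of bounded operators, used to extend the
  correspondence to limits.\<close>

instance chilbert_space \<subseteq> banach ..

text \<open>The correspondence q(U) \<leftrightarrow> q(W) together with its limits. Taking the
  closure of the graph extends it to norm limits without choosing representatives; for equal spectra
  it is the graph of an isometry.\<close>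

definition laurent_graph ::
  "('h::chilbert_space \<Rightarrow>\<^sub>L 'h) \<Rightarrow> ('k::chilbert_space \<Rightarrow>\<^sub>L 'k) \<Rightarrow> (('h \<Rightarrow>\<^sub>L 'h) \<times> ('k \<Rightarrow>\<^sub>L 'k)) set" where
  "laurent_graph U W = closure {(T, S) | T S q. laurent U q T \<and> laurent W q S}"

lemma laurent_graphE:
  assumes "(T, S) \<in> laurent_graph U W"
  obtains X Y q where "\<And>n::nat. laurent U (q n) (X n)" "\<And>n. laurent W (q n) (Y n)"
    "X \<longlonglongrightarrow> T" "Y \<longlonglongrightarrow> S"
proof -
  obtain x where x: "\<And>n. x n \<in> {(T, S) | T S q. laurent U q T \<and> laurent W q S}" "x \<longlonglongrightarrow> (T, S)"
    using assms unfolding laurent_graph_def closure_sequential by blast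
  have "\<exists>q. laurent U q (fst (x n)) \<and> laurent W q (snd (x n))" for n
  proof -
    obtain T S q where "x n = (T, S)" "laurent U q T" "laurent W q S" using x(1)[of n] by blast
    then show ?thesis by auto
  qed
  then obtain q where "\<And>n. laurent U (q n) (fst (x n))" "\<And>n. laurent W (q n) (snd (x n))" by metis
  then show thesis
    using that[of q "\<lambda>n. fst (x n)" "\<lambda>n. snd (x n)"] tendsto_fst[OF x(2)] tendsto_snd[OF x(2)] by simp
qed

lemma laurent_graphI:
  assumes "\<And>n::nat. laurent U (q n) (X n)" "\<And>n. laurent W (q n) (Y n)" "X \<longlonglongrightarrow> T" "Y \<longlonglongrightarrow> S"
  shows "(T, S) \<in> laurent_graph U W"
  unfolding laurent_graph_def closure_sequential
  by (rule exI[of _ "\<lambda>n. (X n, Y n)"]) (use assms in \<open>auto intro: tendsto_Pair\<close>)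

lemma laurent_in_graph: "laurent U q T \<Longrightarrow> laurent W q S \<Longrightarrow> (T, S) \<in> laurent_graph U W"
  by (rule laurent_graphI[of U "\<lambda>_. q" "\<lambda>_. T" W "\<lambda>_. S"]) auto

lemma laurent_graph_sym: "(T, S) \<in> laurent_graph U W \<Longrightarrow> (S, T) \<in> laurent_graph W U"
  by (elim laurent_graphE) (rule laurent_graphI)

lemma unital_cstar_subalgebra_laurent:
  assumes A: "unital_cstar_subalgebra A" "U \<in> A" and L: "laurent U q T"
  shows "T \<in> A"
  using L by induction (use A in \<open>auto simp: unital_cstar_subalgebra_def\<close>)

lemma laurent_graph_scale: "(T, S) \<in> laurent_graph U W \<Longrightarrow> (c *\<^sub>C T, c *\<^sub>C S) \<in> laurent_graph U W"
  by (elim laurent_graphE)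
    (rule laurent_graphI[OF laurent_scale laurent_scale tendsto_scaleC_blinfun tendsto_scaleC_blinfun])

lemma laurent_graph_add:
  assumes "(T, S) \<in> laurent_graph U W" "(T', S') \<in> laurent_graph U W"
  shows "(T + T', S + S') \<in> laurent_graph U W"
  using assms
  by (elim laurent_graphE) (rule laurent_graphI[OF laurent_add laurent_add tendsto_add tendsto_add])

lemma laurent_graph_compose:
  assumes "(T, S) \<in> laurent_graph U W" "(T', S') \<in> laurent_graph U W"
  shows "(T o\<^sub>L T', S o\<^sub>L S') \<in> laurent_graph U W"
  using assms
  by (elim laurent_graphE)
    (rule laurent_graphI[OF laurent_mult laurent_mult
        bounded_bilinear.tendsto[OF bounded_bilinear_blinfun_compose]
        bounded_bilinear.tendsto[OF bounded_bilinear_blinfun_compose]])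

lemma laurent_graph_adj:
  assumes U: "unitary U" and W: "unitary W" and TS: "(T, S) \<in> laurent_graph U W" shows "(adj T, adj S) \<in> laurent_graph U W"
  using TS
  by (elim laurent_graphE)
    (rule laurent_graphI[OF laurent_adj[OF U] laurent_adj[OF W] adj_tendsto adj_tendsto],
      auto intro: laurent_BH[OF U] laurent_BH[OF W])

context
  fixes U :: "'h::chilbert_space \<Rightarrow>\<^sub>L 'h" and W :: "'k::chilbert_space \<Rightarrow>\<^sub>L 'k"
  assumes U: "unitary U" and W: "unitary W" and spec: "spectrum U = spectrum W"
begin

lemma laurent_norm_eq:
  assumes "laurent U q T" "laurent W q S" shows "norm T = norm S"
proof (rule antisym)
  show "norm T \<le> norm S"
    by (rule laurent_norm_le[OF U assms(1)]) (use laurent_norm_ge[OF W assms(2)] spec in auto)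
  show "norm S \<le> norm T"
    by (rule laurent_norm_le[OF W assms(2)]) (use laurent_norm_ge[OF U assms(1)] spec in auto)
qed

lemma laurent_graph_norm:
  assumes "(T, S) \<in> laurent_graph U W" shows "norm T = norm S"
proof -
  obtain X Y q where XY: "\<And>n::nat. laurent U (q n) (X n)" "\<And>n. laurent W (q n) (Y n)"
    "X \<longlonglongrightarrow> T" "Y \<longlonglongrightarrow> S" using laurent_graphE[OF assms] by metis
  have "norm (X n) = norm (Y n)" for n using laurent_norm_eq[OF XY(1,2)] .
  then show ?thesis
    using LIMSEQ_unique[OF tendsto_norm[OF XY(3)]] tendsto_norm[OF XY(4)] by simp
qed

lemma laurent_graph_unique:
  assumes "(T, S) \<in> laurent_graph U W" "(T, S') \<in> laurent_graph U W" shows "S = S'"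
proof -
  have "(T + (-1) *\<^sub>C T, S + (-1) *\<^sub>C S') \<in> laurent_graph U W"
    by (intro laurent_graph_add laurent_graph_scale assms)
  then have "norm (T - T) = norm (S - S')" using laurent_graph_norm by fastforce
  then show ?thesis by simp
qed

text \<open>Closedness is the substantial point: because the correspondence is isometric, partners
  of a convergent sequence form a Cauchy sequence, and the pair of limits lies in the closed
  graph.\<close>

lemma unital_cstar_subalgebra_graph_domain: "unital_cstar_subalgebra (Domain (laurent_graph U W))"
  unfolding unital_cstar_subalgebra_def
proof (intro conjI ballI allI)
  show "Domain (laurent_graph U W) \<subseteq> BH"
  proof (clarify, elim laurent_graphE)
    fix T X q assume "\<And>n::nat. laurent U (q n) (X n)" "X \<longlonglongrightarrow> T"
    then show "T \<in> BH" by (metis BH_tendsto laurent_BH[OF U])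
  qed
  have "laurent U (\<lambda>z. 1) id_blinfun" "laurent W (\<lambda>z. 1) id_blinfun"
    using laurent_const[of _ 1] by (simp_all add: scaleC_one)
  then show "id_blinfun \<in> Domain (laurent_graph U W)" using laurent_in_graph by blast
  show "closed (Domain (laurent_graph U W))"
    unfolding closed_sequential_limits
  proof (intro allI impI, elim conjE)
    fix X T assume X: "\<forall>n. X n \<in> Domain (laurent_graph U W)" "X \<longlonglongrightarrow> T"
    then have "\<forall>n. \<exists>S. (X n, S) \<in> laurent_graph U W" by (simp add: Domain_iff)
    then obtain Y where Y: "\<And>n. (X n, Y n) \<in> laurent_graph U W" by metis
    have "dist (Y m) (Y n) = dist (X m) (X n)" for m n
    proof -
      have "(X m + (-1) *\<^sub>C X n, Y m + (-1) *\<^sub>C Y n) \<in> laurent_graph U W"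
        by (intro laurent_graph_add laurent_graph_scale Y)
      from laurent_graph_norm[OF this] show ?thesis by (simp add: dist_norm)
    qed
    then have "Cauchy Y" using LIMSEQ_imp_Cauchy[OF X(2)] by (simp add: Cauchy_def)
    then have "convergent Y" by (rule Cauchy_convergent)
    then obtain S where S: "Y \<longlonglongrightarrow> S" unfolding convergent_def by blast
    have "(T, S) \<in> laurent_graph U W"
      using closed_sequentially[OF _ Y tendsto_Pair[OF X(2) S]] by (simp add: laurent_graph_def)
    then show "T \<in> Domain (laurent_graph U W)" by blast
  qed
qed (use laurent_graph_add laurent_graph_compose laurent_graph_scale laurent_graph_adj[OF U W] in blast)+

lemma cstar_generated_eq_graph_domain: "cstar_generated U = Domain (laurent_graph U W)"
proof
  have "(U, W) \<in> laurent_graph U W" by (rule laurent_in_graph[OF laurent_gen laurent_gen])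
  then show "cstar_generated U \<subseteq> Domain (laurent_graph U W)"
    unfolding cstar_generated_def using unital_cstar_subalgebra_graph_domain by blast
  show "Domain (laurent_graph U W) \<subseteq> cstar_generated U"
    unfolding cstar_generated_def
  proof clarify
    fix T S A assume "(T, S) \<in> laurent_graph U W" and A: "unital_cstar_subalgebra A" "U \<in> A"
    from this(1) show "T \<in> A"
    proof (rule laurent_graphE)
      fix X Y q assume X: "\<And>n::nat. laurent U (q n) (X n)" "X \<longlonglongrightarrow> T"
      show "T \<in> A"
        by (rule closed_sequentially[OF _ unital_cstar_subalgebra_laurent[OF A X(1)] X(2)])
          (use A in \<open>simp add: unital_cstar_subalgebra_def\<close>)
    qed
  qed
qed

end

section \<open>Isomorphisms of generated algebras and equality of spectra\<close>

lemma unital_cstar_subalgebra_cstar_generated: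
  "unitary U \<Longrightarrow> unital_cstar_subalgebra (cstar_generated U)"
  using cstar_generated_eq_graph_domain[of U U] unital_cstar_subalgebra_graph_domain[of U U] by simp

lemma in_cstar_generated: "U \<in> cstar_generated U"
  by (simp add: cstar_generated_def)

lemma laurent_in_cstar_generated: "unitary U \<Longrightarrow> laurent U q T \<Longrightarrow> T \<in> cstar_generated U"
  using unital_cstar_subalgebra_laurent unital_cstar_subalgebra_cstar_generated in_cstar_generated by blast

theorem star_isomorphism_of_spectrum_eq:
  assumes U: "unitary U" and W: "unitary W" and spec: "spectrum U = spectrum W"
  shows "\<exists>\<pi>. star_isomorphism (cstar_generated U) (cstar_generated W) \<pi> \<and> \<pi> U = W"
proof -
  let ?G = "laurent_graph U W"
  define \<pi> where "\<pi> T = (THE S. (T, S) \<in> ?G)" for T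
  have \<pi>_eq: "\<pi> T = S" if "(T, S) \<in> ?G" for T S
    unfolding \<pi>_def using laurent_graph_unique[OF assms] that by blast
  have dom: "cstar_generated U = Domain ?G" by (rule cstar_generated_eq_graph_domain[OF assms])
  have "cstar_generated W = Domain (laurent_graph W U)"
    by (rule cstar_generated_eq_graph_domain[OF W U spec[symmetric]])
  moreover have "Domain (laurent_graph W U) = Range ?G"
  proof -
    have "(S, T) \<in> laurent_graph W U \<longleftrightarrow> (T, S) \<in> ?G" for S T
      by (rule iffI) (rule laurent_graph_sym, assumption)+
    then show ?thesis by (simp add: set_eq_iff Domain_iff Range_iff)
  qed
  ultimately have ran: "cstar_generated W = Range ?G" by simp
  have graph: "(T, \<pi> T) \<in> ?G" if "T \<in> cstar_generated U" for T
    using that dom \<pi>_eq by blast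
  have "bij_betw \<pi> (cstar_generated U) (cstar_generated W)"
    unfolding bij_betw_def
  proof
    show "inj_on \<pi> (cstar_generated U)"
    proof (rule inj_onI)
      fix S T assume "S \<in> cstar_generated U" "T \<in> cstar_generated U" "\<pi> S = \<pi> T"
      then have "(\<pi> T, S) \<in> laurent_graph W U" "(\<pi> T, T) \<in> laurent_graph W U"
        using graph laurent_graph_sym by metis+
      then show "S = T" by (rule laurent_graph_unique[OF W U spec[symmetric]])
    qed
    show "\<pi> ` cstar_generated U = cstar_generated W"
      unfolding ran dom using \<pi>_eq by (force simp: image_iff)
  qed
  then have "star_isomorphism (cstar_generated U) (cstar_generated W) \<pi>"
    unfolding star_isomorphism_def
    by (auto intro!: \<pi>_eq laurent_graph_add laurent_graph_compose laurent_graph_scale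
        laurent_graph_adj[OF U W] graph)
  moreover have "\<pi> U = W" by (rule \<pi>_eq[OF laurent_in_graph[OF laurent_gen laurent_gen]])
  ultimately show ?thesis by blast
qed

text \<open>Outside the spectrum, the inverse of U - z is a limit of Laurent polynomials in U by a
  Neumann series for (U - z)*(U - z), so it survives under the isomorphism.\<close>

lemma star_isomorphism_spectrum_subset:
  fixes U :: "'h::chilbert_space \<Rightarrow>\<^sub>L 'h" and W :: "'k::chilbert_space \<Rightarrow>\<^sub>L 'k"
  assumes U: "unitary U" and W: "unitary W"
    and \<pi>: "star_isomorphism (cstar_generated U) (cstar_generated W) \<pi>" and \<pi>U: "\<pi> U = W"
  shows "spectrum W \<subseteq> spectrum U"
proof (rule subsetI, rule ccontr)
  fix z assume zW: "z \<in> spectrum W" and zU: "z \<notin> spectrum U"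
  let ?A = "cstar_generated U"
  have alg: "unital_cstar_subalgebra ?A" by (rule unital_cstar_subalgebra_cstar_generated[OF U])
  have z1: "cmod z = 1" by (rule spectrum_norm[OF W zW])
  define T where "T = U - z *\<^sub>C id_blinfun"
  have T: "T \<in> BH" unfolding T_def by (rule shift_BH[OF U])
  obtain S where S: "S \<in> BH" "S o\<^sub>L T = id_blinfun" "T o\<^sub>L S = id_blinfun"
    using zU unfolding spectrum_def T_def by blast
  obtain d where d: "d > 0" "\<And>x. d * norm x \<le> norm (T x)"
    using zU spectrum_iff_not_bounded_below[OF U] unfolding T_def bounded_below_def by blast
  have gap: "d \<le> cmod (w - z)" if w: "w \<in> spectrum U" for w
  proof (rule field_le_epsilon)
    fix e :: real assume "e > 0"
    then obtain x where x: "norm x = 1" "norm (U x - w *\<^sub>C x) < e"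
      using w spectrum_iff_approximate_eigenvalue[OF U] by blast
    have "d \<le> norm (T x)" using d(2)[of x] x(1) by simp
    also have "T x = (U x - w *\<^sub>C x) + (w - z) *\<^sub>C x"
      by (simp add: T_def blinfun.diff_left scaleC_blinfun.rep_eq complex_vector.scale_left_diff_distrib)
    also have "norm \<dots> \<le> norm (U x - w *\<^sub>C x) + norm ((w - z) *\<^sub>C x)" by (rule norm_triangle_ineq)
    also have "\<dots> \<le> e + cmod (w - z)" using x by (simp add: norm_scaleC)
    finally show "d \<le> cmod (w - z) + e" by simp
  qed
  \<comment> \<open>Since |w - z| \<le> 2 on the circle, the factor 1/4 places the function of
    \<open>N\<close> in [d^2 / 4, 1] on the spectrum, so 1 - q is bounded there by a constant below
    1 and the geometric series converges.\<close>
  define N where "N = (1 / 4) *\<^sub>C (adj T o\<^sub>L T)"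
  define q where "q w = (1 / 4) * (cnj (w - z) * (w - z))" for w
  have LT: "laurent U (\<lambda>w. w - z) T" unfolding T_def by (intro laurent_diff laurent_gen laurent_const)
  have LN: "laurent U q N"
    unfolding N_def q_def by (intro laurent_scale laurent_mult laurent_adj[OF U] LT)
  define \<rho> where "\<rho> = max 0 (1 - d\<^sup>2 / 4)"
  have \<rho>: "0 \<le> \<rho>" "\<rho> < 1" using d(1) by (auto simp: \<rho>_def)
  have q_bound: "cmod (1 - q w) \<le> \<rho>" if w: "w \<in> spectrum U" for w
  proof -
    have q_eq: "q w = of_real ((cmod (w - z))\<^sup>2 / 4)"
      using complex_norm_square[of "w - z"] by (simp add: q_def mult.commute)
    have "cmod (w - z) \<le> 2"
      using norm_triangle_ineq4[of w z] z1 spectrum_norm[OF U w] by simp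
    then have "(cmod (w - z))\<^sup>2 \<le> 2\<^sup>2" by (intro power_mono) auto
    moreover have "d\<^sup>2 \<le> (cmod (w - z))\<^sup>2" using gap[OF w] d(1) by (intro power_mono) auto
    moreover have "cmod (1 - q w) = \<bar>1 - (cmod (w - z))\<^sup>2 / 4\<bar>"
      unfolding q_eq by (metis norm_of_real of_real_1 of_real_diff)
    ultimately show ?thesis by (simp add: \<rho>_def)
  qed
  have "\<exists>R. laurent U (\<lambda>w. \<Sum>j<k. (1 - q w) ^ j) R" for k :: nat
  proof (induction k)
    case 0
    then show ?case using laurent_const[of U 0] by auto
  next
    case (Suc k)
    have "\<exists>R. laurent U (\<lambda>w. (1 - q w) ^ k) R"
    proof (induction k)
      case (Suc k)
      then show ?case using laurent_mult[OF laurent_diff[OF laurent_const[of U 1] LN]] by auto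
    qed (use laurent_const[of U 1] in auto)
    then show ?case using Suc laurent_add by fastforce
  qed
  then obtain R where R: "\<And>k::nat. laurent U (\<lambda>w. \<Sum>j<k. (1 - q w) ^ j) (R k)" by metis
  \<comment> \<open>The inverse of \<open>N\<close>, towards which the partial sums
    \<open>R k\<close> converge.\<close>
  define J where "J = (4::complex) *\<^sub>C (S o\<^sub>L adj S)"
  have ST: "S (T x) = x" "T (S x) = x" for x
    using S(2,3) by (metis blinfun_apply_blinfun_compose blinfun_apply_id_blinfun id_apply)+
  have aST: "adj T (adj S x) = x" "adj S (adj T x) = x" for x
    using arg_cong[OF S(2), of adj] arg_cong[OF S(3), of adj] S(1) T
    by (simp_all add: adj_compose) (metis blinfun_apply_blinfun_compose blinfun_apply_id_blinfun id_apply)+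
  have NJ: "N o\<^sub>L J = id_blinfun"
    by (rule blinfun_eqI)
      (simp add: N_def J_def scaleC_blinfun.rep_eq BH_scaleC T adj_BH scaleC_scaleC ST aST scaleC_one)
  have JT: "(J o\<^sub>L adj T) o\<^sub>L T = (4::complex) *\<^sub>C id_blinfun"
    by (rule blinfun_eqI) (simp add: J_def scaleC_blinfun.rep_eq ST aST)
  have RJ: "norm (R k - J) \<le> \<rho> ^ k * norm J" for k
  proof -
    have "laurent U (\<lambda>w. (\<Sum>j<k. (1 - q w) ^ j) * q w - 1) ((R k o\<^sub>L N) - 1 *\<^sub>C id_blinfun)"
      by (intro laurent_diff laurent_mult R LN laurent_const)
    moreover have "(\<Sum>j<k. (1 - q w) ^ j) * q w - 1 = - ((1 - q w) ^ k)" for w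
    proof -
      have eq: "q w * (\<Sum>j<k. (1 - q w) ^ j) = 1 - (1 - q w) ^ k"
        using one_diff_power_eq[of "1 - q w" k] by simp
      show ?thesis unfolding mult.commute[of _ "q w"] eq by simp
    qed
    ultimately have "laurent U (\<lambda>w. - ((1 - q w) ^ k)) ((R k o\<^sub>L N) - id_blinfun)"
      by (simp add: scaleC_one)
    then have le: "norm ((R k o\<^sub>L N) - id_blinfun) \<le> \<rho> ^ k"
      by (rule laurent_norm_le[OF U]) (use \<rho> q_bound in \<open>auto simp: norm_power intro: power_mono\<close>)
    have "R k - J = ((R k o\<^sub>L N) - id_blinfun) o\<^sub>L J"
    proof (rule blinfun_eqI)
      fix x
      have "N (J x) = x" using NJ by (metis blinfun_apply_blinfun_compose blinfun_apply_id_blinfun id_apply)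
      then show "(R k - J) x = (((R k o\<^sub>L N) - id_blinfun) o\<^sub>L J) x" by (simp add: blinfun.diff_left)
    qed
    then have "norm (R k - J) \<le> norm ((R k o\<^sub>L N) - id_blinfun) * norm J"
      by (metis norm_blinfun_compose)
    also have "\<dots> \<le> \<rho> ^ k * norm J" by (rule mult_right_mono[OF le norm_ge_zero])
    finally show ?thesis .
  qed
  have "(\<lambda>k. \<rho> ^ k * norm J) \<longlonglongrightarrow> 0 * norm J"
    by (intro tendsto_intros LIMSEQ_power_zero) (use \<rho> in auto)
  then have "(\<lambda>k. R k - J) \<longlonglongrightarrow> 0"
    by (intro Lim_null_comparison[OF always_eventually[OF allI[OF RJ]]]) simp
  then have "R \<longlonglongrightarrow> J" by (simp add: LIM_zero_iff)
  then have JA: "J \<in> ?A"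
    using alg laurent_in_cstar_generated[OF U R]
    by (intro closed_sequentially[of ?A R J]) (auto simp: unital_cstar_subalgebra_def)
  have idA: "id_blinfun \<in> ?A" and UA: "U \<in> ?A"
    using alg by (auto simp: unital_cstar_subalgebra_def in_cstar_generated)
  have hom: "\<pi> (X + Y) = \<pi> X + \<pi> Y" "\<pi> (X o\<^sub>L Y) = \<pi> X o\<^sub>L \<pi> Y" "\<pi> (c *\<^sub>C X) = c *\<^sub>C \<pi> X"
    if "X \<in> ?A" "Y \<in> ?A" for X Y c
    using \<pi> that unfolding star_isomorphism_def by blast+
  \<comment> \<open>\<open>star_isomorphism\<close> does not list preservation of the unit; it
    follows by multiplying by a preimage of the identity.\<close>
  have "id_blinfun \<in> \<pi> ` ?A"
    using \<pi> unital_cstar_subalgebra_cstar_generated[OF W]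
    by (auto simp: star_isomorphism_def bij_betw_def unital_cstar_subalgebra_def)
  then obtain E where E: "E \<in> ?A" "\<pi> E = id_blinfun" by auto
  have \<pi>1: "\<pi> id_blinfun = id_blinfun"
  proof -
    have "\<pi> (id_blinfun o\<^sub>L E) = \<pi> id_blinfun" unfolding hom(2)[OF idA E(1)] E(2) by (rule blinfun_eqI) simp
    moreover have "id_blinfun o\<^sub>L E = E" by (rule blinfun_eqI) simp
    ultimately show ?thesis using E(2) by simp
  qed
  have TA: "T \<in> ?A" by (rule laurent_in_cstar_generated[OF U LT])
  have LA: "J o\<^sub>L adj T \<in> ?A" using alg JA TA unfolding unital_cstar_subalgebra_def by blast
  have \<pi>T: "\<pi> T = W - z *\<^sub>C id_blinfun"
  proof -
    have T_eq: "T = U + (- z) *\<^sub>C id_blinfun" by (simp add: T_def)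
    have "(- z) *\<^sub>C id_blinfun \<in> ?A" using alg idA unfolding unital_cstar_subalgebra_def by blast
    from hom(1)[OF UA this] have "\<pi> T = W + (- z) *\<^sub>C id_blinfun"
      unfolding T_eq hom(3)[OF idA idA] \<pi>1 \<pi>U .
    then show ?thesis by simp
  qed
  \<comment> \<open>A left inverse of W - z up to the factor 4, which suffices for a lower
    bound.\<close>
  have "\<pi> (J o\<^sub>L adj T) o\<^sub>L (W - z *\<^sub>C id_blinfun) = (4::complex) *\<^sub>C id_blinfun"
    using hom(2)[OF LA TA] hom(3)[OF idA idA] by (simp add: JT \<pi>1 \<pi>T)
  then have left: "\<pi> (J o\<^sub>L adj T) ((W - z *\<^sub>C id_blinfun) x) = 4 *\<^sub>C x" for x
    by (metis blinfun_apply_blinfun_compose blinfun_apply_id_blinfun id_apply scaleC_blinfun.rep_eq)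
  define B where "B = norm (\<pi> (J o\<^sub>L adj T)) + 1"
  have B: "B > 0" by (simp add: B_def add_nonneg_pos)
  have "4 / B * norm x \<le> norm ((W - z *\<^sub>C id_blinfun) x)" for x
  proof -
    have "4 * norm x = norm (\<pi> (J o\<^sub>L adj T) ((W - z *\<^sub>C id_blinfun) x))" by (simp add: left norm_scaleC)
    also have "\<dots> \<le> norm (\<pi> (J o\<^sub>L adj T)) * norm ((W - z *\<^sub>C id_blinfun) x)" by (rule norm_blinfun)
    also have "\<dots> \<le> B * norm ((W - z *\<^sub>C id_blinfun) x)" by (simp add: B_def mult_right_mono)
    finally have "4 * norm x / B \<le> norm ((W - z *\<^sub>C id_blinfun) x)"
      using B by (subst pos_divide_le_eq) (auto simp: mult.commute)
    then show ?thesis by simp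
  qed
  then have "bounded_below (W - z *\<^sub>C id_blinfun)"
    unfolding bounded_below_def using B by (intro exI[of _ "4 / B"]) auto
  then show False using zW spectrum_iff_not_bounded_below[OF W] by blast
qed

lemma star_isomorphism_inv_into:
  assumes A: "unital_cstar_subalgebra A" and \<pi>: "star_isomorphism A B \<pi>"
  shows "star_isomorphism B A (inv_into A \<pi>)"
proof -
  have bij: "bij_betw \<pi> A B" using \<pi> by (simp add: star_isomorphism_def)
  let ?i = "inv_into A \<pi>"
  have iA: "?i S \<in> A" and \<pi>i: "\<pi> (?i S) = S" if "S \<in> B" for S
    using that bij by (auto simp: bij_betw_def inv_into_into f_inv_into_f)
  have eqI: "?i S = T" if "T \<in> A" "\<pi> T = S" for S T
    using that bij by (auto simp: bij_betw_def)
  show ?thesis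
    using \<pi> A unfolding star_isomorphism_def unital_cstar_subalgebra_def
    by (auto intro!: bij_betw_inv_into bij eqI simp: iA \<pi>i)
qed

theorem star_isomorphism_spectrum_eq:
  assumes U: "unitary U" and W: "unitary W"
    and \<pi>: "star_isomorphism (cstar_generated U) (cstar_generated W) \<pi>" and \<pi>U: "\<pi> U = W"
  shows "spectrum U = spectrum W"
proof
  show "spectrum W \<subseteq> spectrum U" by (rule star_isomorphism_spectrum_subset[OF assms])
  let ?i = "inv_into (cstar_generated U) \<pi>"
  have i: "star_isomorphism (cstar_generated W) (cstar_generated U) ?i"
    by (rule star_isomorphism_inv_into[OF unital_cstar_subalgebra_cstar_generated[OF U] \<pi>])
  have "inj_on \<pi> (cstar_generated U)" using \<pi> by (auto simp: star_isomorphism_def bij_betw_def)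
  then have "?i W = U" using \<pi>U in_cstar_generated by (metis inv_into_f_f)
  then show "spectrum U \<subseteq> spectrum W" by (rule star_isomorphism_spectrum_subset[OF W U i])
qed

lemma cstar_generated_adj:
  assumes "unitary V" shows "cstar_generated (adj V) = cstar_generated V"
proof -
  have "adj V \<in> A \<longleftrightarrow> V \<in> A" if "unital_cstar_subalgebra A" for A
    using that adj_adj[OF unitary_BH[OF assms]] unfolding unital_cstar_subalgebra_def by metis
  then show ?thesis unfolding cstar_generated_def by (metis (no_types, lifting))
qed

lemma cstar_generated_cscale:
  assumes "c \<noteq> 0" shows "cstar_generated (c *\<^sub>C V) = cstar_generated V"
proof -
  have "c *\<^sub>C V \<in> A \<longleftrightarrow> V \<in> A" if "unital_cstar_subalgebra A" for A
  proof -
    have "V = (1 / c) *\<^sub>C (c *\<^sub>C V)" using assms by (simp add: scaleC_scaleC scaleC_one)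
    then show ?thesis using that unfolding unital_cstar_subalgebra_def by metis
  qed
  then show ?thesis unfolding cstar_generated_def by (metis (no_types, lifting))
qed

section \<open>Operator systems\<close>

text \<open>On the plane these are exactly the real-affine maps, which ties them to convex hulls; as
  functions of a unitary they are the symbols of the elements of its operator system.\<close>

definition trig :: "complex \<Rightarrow> complex \<Rightarrow> complex \<Rightarrow> complex \<Rightarrow> complex" where
  "trig a b c z = a + b * z + c * cnj z"

definition trig_op :: "('h::chilbert_space \<Rightarrow>\<^sub>L 'h) \<Rightarrow> complex \<Rightarrow> complex \<Rightarrow> complex \<Rightarrow> ('h \<Rightarrow>\<^sub>L 'h)" where
  "trig_op U a b c = a *\<^sub>C id_blinfun + b *\<^sub>C U + c *\<^sub>C adj U"

lemma laurent_trig_op: "laurent U (trig a b c) (trig_op U a b c)"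
  unfolding trig_op_def trig_def[abs_def]
  by (intro laurent_add laurent_scale laurent_const laurent_gen laurent_cnj)

lemma OSy_iff: "T \<in> OSy U \<longleftrightarrow> (\<exists>a b c. T = trig_op U a b c)"
proof -
  have "T \<in> OSy U \<longleftrightarrow> (\<exists>a b c. T - a *\<^sub>C id_blinfun - b *\<^sub>C U - c *\<^sub>C adj U = 0)"
    by (simp add: OSy_def complex_vector.span_breakdown_eq)
  also have "\<dots> \<longleftrightarrow> (\<exists>a b c. T = trig_op U a b c)"
    by (simp add: trig_op_def algebra_simps)
  finally show ?thesis .
qed

lemma OSy_add: "S \<in> OSy U \<Longrightarrow> T \<in> OSy U \<Longrightarrow> S + T \<in> OSy U"
  and OSy_scale: "T \<in> OSy U \<Longrightarrow> c *\<^sub>C T \<in> OSy U"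
  and OSy_generators: "id_blinfun \<in> OSy U" "U \<in> OSy U" "adj U \<in> OSy U"
  unfolding OSy_def
  by (auto intro: complex_vector.span_add complex_vector.span_scale complex_vector.span_base)

context
  fixes U :: "'h::chilbert_space \<Rightarrow>\<^sub>L 'h"
  assumes U: "unitary U"
begin

lemma laurent_values_unique:
  assumes "laurent U q T" "laurent U r T" "z \<in> spectrum U" shows "q z = r z"
  using laurent_norm_ge[OF U laurent_diff[OF assms(1,2)] assms(3)] by simp

lemma closed_spectrum: "closed (spectrum U)"
  unfolding closed_sequential_limits
proof (intro allI impI, elim conjE)
  fix w l assume w: "\<forall>n. w n \<in> spectrum U" and lim: "w \<longlonglongrightarrow> l"
  have "\<exists>x. norm x = 1 \<and> norm (U x - l *\<^sub>C x) < e" if e: "e > 0" for e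
  proof -
    obtain n where n: "dist (w n) l < e / 2" using metric_LIMSEQ_D[OF lim, of "e / 2"] e by auto
    obtain x where x: "norm x = 1" "norm (U x - w n *\<^sub>C x) < e / 2"
      using w e spectrum_iff_approximate_eigenvalue[OF U] half_gt_zero by blast
    have "U x - l *\<^sub>C x = (U x - w n *\<^sub>C x) + (w n - l) *\<^sub>C x"
      by (simp add: complex_vector.scale_left_diff_distrib)
    also have "norm \<dots> \<le> norm (U x - w n *\<^sub>C x) + norm ((w n - l) *\<^sub>C x)" by (rule norm_triangle_ineq)
    also have "\<dots> < e" using x n by (simp add: norm_scaleC dist_norm)
    finally show ?thesis using x(1) by blast
  qed
  then show "l \<in> spectrum U" using spectrum_iff_approximate_eigenvalue[OF U] by blast
qed

text \<open>Makes the convex hull of the spectrum closed, as needed for separation by a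
  line.\<close>

lemma compact_spectrum: "compact (spectrum U)"
proof -
  have "bounded (spectrum U)" using spectrum_norm[OF U] by (intro boundedI[of _ 1]) auto
  then show ?thesis using closed_spectrum compact_eq_bounded_closed by blast
qed

lemma matrix_positive_1_iff:
  assumes L: "laurent U q T"
  shows "matrix_positive 1 (\<lambda>_ _. T) \<longleftrightarrow> (\<forall>z\<in>spectrum U. q z \<in> \<real>\<^sub>\<ge>\<^sub>0)"
proof -
  have "(\<forall>v::nat \<Rightarrow> complex. q z * v 0 * cnj (v 0) \<in> \<real>\<^sub>\<ge>\<^sub>0) \<longleftrightarrow> q z \<in> \<real>\<^sub>\<ge>\<^sub>0" for z
  proof
    assume *: "\<forall>v::nat \<Rightarrow> complex. q z * v 0 * cnj (v 0) \<in> \<real>\<^sub>\<ge>\<^sub>0"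
    show "q z \<in> \<real>\<^sub>\<ge>\<^sub>0" using spec[OF *, of "\<lambda>_. 1"] by simp
  next
    assume q: "q z \<in> \<real>\<^sub>\<ge>\<^sub>0"
    have "v * cnj v \<in> \<real>\<^sub>\<ge>\<^sub>0" for v
      unfolding complex_norm_square[symmetric] by (simp flip: of_real_power)
    then show "\<forall>v::nat \<Rightarrow> complex. q z * v 0 * cnj (v 0) \<in> \<real>\<^sub>\<ge>\<^sub>0"
      using q by (simp add: mult.assoc nonneg_Reals_mult_I)
  qed
  then show ?thesis
    using laurent_matrix_positive_iff[OF U, of 1 "\<lambda>_ _. q" "\<lambda>_ _. T"] L by simp
qed

end

text \<open>Let f and g be the functions of \<phi> U and \<phi> (\<open>adj U\<close>). Positivity
  of 2 + d U + \<open>cnj d\<close> (\<open>adj U\<close>) for |d| = 1 forces g = \<open>cnj\<close>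
  f on the spectrum of \<open>V\<close>. An affine function positive on the spectrum of
  \<open>U\<close> is then nonnegative at f y, so no line separates f y from the hull.\<close>

lemma ucp_trig:
  fixes U :: "'h::chilbert_space \<Rightarrow>\<^sub>L 'h" and V :: "'k::chilbert_space \<Rightarrow>\<^sub>L 'k"
  assumes U: "unitary U" and V: "unitary V" and ucp: "unital_completely_positive (OSy U) (OSy V) \<phi>"
  shows "\<exists>a b c. \<phi> U = trig_op V a b c \<and>
    (\<forall>\<alpha> \<beta> \<gamma>. laurent V (\<lambda>y. trig \<alpha> \<beta> \<gamma> (trig a b c y)) (\<phi> (trig_op U \<alpha> \<beta> \<gamma>))) \<and>
    trig a b c ` spectrum V \<subseteq> convex hull spectrum U"
proof -
  note gen = OSy_generators[of U]
  note u1 = ucp[unfolded unital_completely_positive_def]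
  note u2 = conjunct2[OF u1] note u3 = conjunct2[OF u2] note u4 = conjunct2[OF u3]
  have \<phi>: "\<phi> ` OSy U \<subseteq> OSy V" "\<phi> id_blinfun = id_blinfun"
    "\<And>S T. S \<in> OSy U \<Longrightarrow> T \<in> OSy U \<Longrightarrow> \<phi> (S + T) = \<phi> S + \<phi> T"
    "\<And>c T. T \<in> OSy U \<Longrightarrow> \<phi> (c *\<^sub>C T) = c *\<^sub>C \<phi> T"
    using conjunct1[OF u1] conjunct1[OF u2] conjunct1[OF u3] conjunct1[OF u4] by blast+
  have pos: "matrix_positive 1 (\<lambda>_ _. \<phi> T)" if "T \<in> OSy U" "matrix_positive 1 (\<lambda>_ _. T)" for T
    using conjunct2[OF u4, rule_format, of 1 "\<lambda>_ _. T"] that by simp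
  obtain a b c where abc: "\<phi> U = trig_op V a b c" using \<phi>(1) gen(2) OSy_iff by blast
  obtain a' b' c' where abc': "\<phi> (adj U) = trig_op V a' b' c'" using \<phi>(1) gen(3) OSy_iff by blast
  let ?f = "trig a b c" and ?g = "trig a' b' c'"
  have lin: "\<phi> (trig_op U \<alpha> \<beta> \<gamma>) = \<alpha> *\<^sub>C id_blinfun + \<beta> *\<^sub>C \<phi> U + \<gamma> *\<^sub>C \<phi> (adj U)" for \<alpha> \<beta> \<gamma>
    unfolding trig_op_def by (simp add: \<phi> gen OSy_add OSy_scale)
  have L: "laurent V (\<lambda>y. \<alpha> + \<beta> * ?f y + \<gamma> * ?g y) (\<phi> (trig_op U \<alpha> \<beta> \<gamma>))" for \<alpha> \<beta> \<gamma>
    unfolding lin abc abc' by (intro laurent_add laurent_scale laurent_const laurent_trig_op)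
  have pos': "\<alpha> + \<beta> * ?f y + \<gamma> * ?g y \<in> \<real>\<^sub>\<ge>\<^sub>0"
    if "\<And>x. x \<in> spectrum U \<Longrightarrow> trig \<alpha> \<beta> \<gamma> x \<in> \<real>\<^sub>\<ge>\<^sub>0" "y \<in> spectrum V" for \<alpha> \<beta> \<gamma> y
  proof -
    have "matrix_positive 1 (\<lambda>_ _. trig_op U \<alpha> \<beta> \<gamma>)"
      using matrix_positive_1_iff[OF U laurent_trig_op] that(1) by blast
    then have "matrix_positive 1 (\<lambda>_ _. \<phi> (trig_op U \<alpha> \<beta> \<gamma>))"
      by (intro pos) (auto simp: OSy_iff)
    then show ?thesis using matrix_positive_1_iff[OF V L] that(2) by blast
  qed
  have g_eq: "?g y = cnj (?f y)" if y: "y \<in> spectrum V" for y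
  proof -
    have im: "Im (d * ?f y + cnj d * ?g y) = 0" if d: "cmod d = 1" for d
    proof -
      have "2 + d * ?f y + cnj d * ?g y \<in> \<real>\<^sub>\<ge>\<^sub>0"
      proof (rule pos'[OF _ y])
        fix x assume "x \<in> spectrum U"
        then have "cmod (d * x) = 1" using d spectrum_norm[OF U] by (simp add: norm_mult)
        then have "- 1 \<le> Re (d * x)" using abs_Re_le_cmod[of "d * x"] by linarith
        moreover have "trig 2 d (cnj d) x = 2 + (d * x + cnj (d * x))" by (simp add: trig_def)
        then have "trig 2 d (cnj d) x = of_real (2 + 2 * Re (d * x))"
          by (simp only: complex_add_cnj of_real_add of_real_numeral)
        ultimately show "trig 2 d (cnj d) x \<in> \<real>\<^sub>\<ge>\<^sub>0" by (simp only: nonneg_Reals_of_real_iff)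
      qed
      then show ?thesis by (simp add: complex_nonneg_Reals_iff)
    qed
    \<comment> \<open>d = 1 gives opposite imaginary parts, d = i equal real parts.\<close>
    show ?thesis using im[of 1] im[of \<i>] by (simp add: complex_eq_iff)
  qed
  have "\<phi> (adj U) = adj (\<phi> U)"
    unfolding abc abc'
    by (rule laurent_eqI[OF V laurent_trig_op laurent_adj[OF V laurent_trig_op]]) (rule g_eq)
  then have L': "laurent V (\<lambda>y. trig \<alpha> \<beta> \<gamma> (?f y)) (\<phi> (trig_op U \<alpha> \<beta> \<gamma>))" for \<alpha> \<beta> \<gamma>
    unfolding lin trig_def[of \<alpha> \<beta> \<gamma>] abc
    by (auto intro!: laurent_add laurent_scale laurent_const laurent_trig_op laurent_adj[OF V])
  have "?f y \<in> convex hull spectrum U" if y: "y \<in> spectrum V" for y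
  proof (rule ccontr)
    assume "?f y \<notin> convex hull spectrum U"
    then obtain u t where ut: "inner u (?f y) < t" "\<And>x. x \<in> convex hull spectrum U \<Longrightarrow> inner u x > t"
      using separating_hyperplane_closed_point[of "convex hull spectrum U" "?f y"]
        compact_imp_closed[OF compact_convex_hull[OF compact_spectrum[OF U]]] by auto
    \<comment> \<open>The separating half-plane as an element of the operator system: the inner
      product of u and x is Re (\<open>cnj\<close> u * x).\<close>
    have trig_inner: "trig (- of_real t) (cnj u / 2) (u / 2) x = of_real (inner u x - t)" for x
      by (simp add: trig_def complex_eq_iff inner_complex_def diff_divide_distrib)
    have "trig (- of_real t) (cnj u / 2) (u / 2) (?f y) \<in> \<real>\<^sub>\<ge>\<^sub>0"
      unfolding trig_def[of "- of_real t"] g_eq[OF y, symmetric]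
    proof (rule pos'[OF _ y])
      fix x assume "x \<in> spectrum U"
      then have "t < inner u x" by (intro ut(2) hull_inc)
      then show "trig (- of_real t) (cnj u / 2) (u / 2) x \<in> \<real>\<^sub>\<ge>\<^sub>0"
        unfolding trig_inner by (simp only: nonneg_Reals_of_real_iff)
    qed
    then show False unfolding trig_inner using ut(1) by (simp add: nonneg_Reals_of_real_iff del: of_real_diff)
  qed
  then have "?f ` spectrum V \<subseteq> convex hull spectrum U" by blast
  then show ?thesis by (intro exI[of _ a] exI[of _ b] exI[of _ c] conjI allI abc L')
qed

section \<open>Convex hulls and extreme points of spectra\<close>

lemma trig_affine:
  assumes "u + v = 1" shows "trig a b c (u *\<^sub>R x + v *\<^sub>R y) = u *\<^sub>R trig a b c x + v *\<^sub>R trig a b c y"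
proof -
  have "a = u *\<^sub>R a + v *\<^sub>R a" using assms by (metis scaleR_add_left scaleR_one)
  then have "trig a b c (u *\<^sub>R x + v *\<^sub>R y) = (u *\<^sub>R a + v *\<^sub>R a) + b * (u *\<^sub>R x + v *\<^sub>R y) + c * cnj (u *\<^sub>R x + v *\<^sub>R y)"
    unfolding trig_def by simp
  then show ?thesis by (simp add: trig_def scaleR_conv_of_real algebra_simps)
qed

lemma trig_image_hull:
  assumes "trig a b c ` X \<subseteq> convex hull Y" "x \<in> convex hull X"
  shows "trig a b c x \<in> convex hull Y"
proof -
  have "convex {x. trig a b c x \<in> convex hull Y}"
    by (auto simp: convex_def trig_affine intro!: convexD[OF convex_convex_hull])
  then have "convex hull X \<subseteq> {x. trig a b c x \<in> convex hull Y}"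
    by (intro hull_minimal) (use assms in auto)
  then show ?thesis using assms by blast
qed

text \<open>A real-affine bijection between the convex hulls preserves extreme points, and every point
  of a subset of the circle is extreme in its hull.\<close>

lemma trig_extreme:
  assumes X: "X \<subseteq> sphere 0 1" and Y: "Y \<subseteq> sphere 0 1"
    and f: "trig a b c ` Y \<subseteq> convex hull X" and g: "trig a' b' c' ` X \<subseteq> convex hull Y"
    and gf: "\<And>y. y \<in> Y \<Longrightarrow> trig a' b' c' (trig a b c y) = y"
    and fg: "\<And>x. x \<in> X \<Longrightarrow> trig a b c (trig a' b' c' x) = x"
  shows "trig a b c ` Y \<subseteq> X"
proof
  let ?f = "trig a b c" and ?g = "trig a' b' c'"
  \<comment> \<open>The fixed points of an affine map form a convex set, so the inverse relation
    extends from X to its hull.\<close>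
  have "convex {x. ?f (?g x) = x}" by (auto simp: convex_def trig_affine)
  then have "convex hull X \<subseteq> {x. ?f (?g x) = x}" using fg by (intro hull_minimal) auto
  then have fg': "?f (?g x) = x" if "x \<in> convex hull X" for x using that by blast
  have hullY: "norm w \<le> 1" if "w \<in> convex hull Y" for w
  proof -
    have "convex hull Y \<subseteq> cball 0 1" using Y by (intro hull_minimal) auto
    then show ?thesis using that by auto
  qed
  \<comment> \<open>Quantitative strict convexity of the squared norm: a unit vector strictly
    between two points of the unit disc forces these points to coincide.\<close>
  have sq: "(norm ((1 - t) *\<^sub>R u + t *\<^sub>R v))\<^sup>2 =
      (1 - t) * (norm u)\<^sup>2 + t * (norm v)\<^sup>2 - t * (1 - t) * (norm (u - v))\<^sup>2"
    for t :: real and u v :: complex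
    unfolding cmod_power2 by (simp add: power2_eq_square algebra_simps)
  fix x assume "x \<in> ?f ` Y"
  then obtain y where y: "y \<in> Y" "x = ?f y" by blast
  have "x extreme_point_of (convex hull X)"
    unfolding extreme_point_of_def
  proof (intro conjI ballI notI)
    show "x \<in> convex hull X" using f y by blast
    fix p q assume pq: "p \<in> convex hull X" "q \<in> convex hull X" and "x \<in> open_segment p q"
    then obtain t where t: "0 < t" "t < 1" "p \<noteq> q" "x = (1 - t) *\<^sub>R p + t *\<^sub>R q"
      by (auto simp: in_segment)
    have "y = ?g x" using gf[OF y(1)] y(2) by simp
    also have "\<dots> = (1 - t) *\<^sub>R ?g p + t *\<^sub>R ?g q" unfolding t(4) by (rule trig_affine) simp
    finally have y_eq: "y = (1 - t) *\<^sub>R ?g p + t *\<^sub>R ?g q" .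
    have le: "norm (?g p) \<le> 1" "norm (?g q) \<le> 1"
      using hullY trig_image_hull[OF g] pq by blast+
    define s where "s = (1 - t) * (norm (?g p))\<^sup>2 + t * (norm (?g q))\<^sup>2"
    define k where "k = t * (1 - t) * (norm (?g p - ?g q))\<^sup>2"
    have "(norm y)\<^sup>2 = s - k"
      unfolding y_eq s_def k_def by (rule sq)
    moreover have "(norm y)\<^sup>2 = 1" using y(1) Y by auto
    moreover have "s \<le> (1 - t) * 1 + t * 1"
      unfolding s_def using t le by (intro add_mono mult_left_mono power_le_one) auto
    ultimately have "k \<le> 0" by simp
    then have "t * (1 - t) * (norm (?g p - ?g q))\<^sup>2 \<le> 0" by (simp only: k_def)
    then have "?g p = ?g q" using t by (auto simp: mult_le_0_iff)
    then show False using fg'[OF pq(1)] fg'[OF pq(2)] t(3) by simp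
  qed
  then show "x \<in> X" by (rule extreme_point_of_convex_hull)
qed

text \<open>Expressing \<open>V\<close> as the image of its preimage shows that the composite of the
  two functions and the identity both represent \<open>V\<close>, so they agree on its spectrum;
  likewise for \<open>U\<close>. Extreme points then move the images from the hulls into the
  spectra.\<close>

theorem completely_order_isomorphicD:
  fixes U :: "'h::chilbert_space \<Rightarrow>\<^sub>L 'h" and V :: "'k::chilbert_space \<Rightarrow>\<^sub>L 'k"
  assumes U: "unitary U" and V: "unitary V" and iso: "completely_order_isomorphic (OSy U) (OSy V)"
  shows "\<exists>a b c a' b' c'.
    (\<forall>y\<in>spectrum V. trig a b c y \<in> spectrum U \<and> trig a' b' c' (trig a b c y) = y) \<and>
    (\<forall>x\<in>spectrum U. trig a' b' c' x \<in> spectrum V \<and> trig a b c (trig a' b' c' x) = x)"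
proof -
  obtain \<phi> where bij: "bij_betw \<phi> (OSy U) (OSy V)"
    and \<phi>: "unital_completely_positive (OSy U) (OSy V) \<phi>"
    and \<psi>: "unital_completely_positive (OSy V) (OSy U) (inv_into (OSy U) \<phi>)"
    using iso unfolding completely_order_isomorphic_def complete_order_isomorphism_def by blast
  let ?\<psi> = "inv_into (OSy U) \<phi>"
  obtain a b c where f: "\<phi> U = trig_op V a b c"
    "\<And>\<alpha> \<beta> \<gamma>. laurent V (\<lambda>y. trig \<alpha> \<beta> \<gamma> (trig a b c y)) (\<phi> (trig_op U \<alpha> \<beta> \<gamma>))"
    "trig a b c ` spectrum V \<subseteq> convex hull spectrum U"
    using ucp_trig[OF U V \<phi>] by blast
  obtain a' b' c' where g: "?\<psi> V = trig_op U a' b' c'"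
    "\<And>\<alpha> \<beta> \<gamma>. laurent U (\<lambda>y. trig \<alpha> \<beta> \<gamma> (trig a' b' c' y)) (?\<psi> (trig_op V \<alpha> \<beta> \<gamma>))"
    "trig a' b' c' ` spectrum U \<subseteq> convex hull spectrum V"
    using ucp_trig[OF V U \<psi>] by blast
  have "\<phi> (?\<psi> V) = V" using bij OSy_generators(2)[of V] by (auto simp: bij_betw_def f_inv_into_f)
  then have "laurent V (\<lambda>y. trig a' b' c' (trig a b c y)) V" using f(2)[of a' b' c'] g(1) by simp
  then have gf: "trig a' b' c' (trig a b c y) = y" if "y \<in> spectrum V" for y
    using laurent_values_unique[OF V _ laurent_gen that] by blast
  have "?\<psi> (\<phi> U) = U" using bij OSy_generators(2)[of U] by (auto simp: bij_betw_def)
  then have "laurent U (\<lambda>y. trig a b c (trig a' b' c' y)) U" using g(2)[of a b c] f(1) by simp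
  then have fg: "trig a b c (trig a' b' c' x) = x" if "x \<in> spectrum U" for x
    using laurent_values_unique[OF U _ laurent_gen that] by blast
  have sph: "spectrum U \<subseteq> sphere 0 1" "spectrum V \<subseteq> sphere 0 1"
    using spectrum_norm[OF U] spectrum_norm[OF V] by auto
  have "trig a b c ` spectrum V \<subseteq> spectrum U" by (rule trig_extreme[OF sph f(3) g(3) gf fg])
  moreover have "trig a' b' c' ` spectrum U \<subseteq> spectrum V"
    by (rule trig_extreme[OF sph(2,1) g(3) f(3) fg gf])
  ultimately show ?thesis using gf fg by blast
qed

section \<open>Completely positive maps induced by functions between spectra\<close>

definition pullback_rel ::
  "(complex \<Rightarrow> complex) \<Rightarrow> ('h::chilbert_space \<Rightarrow>\<^sub>L 'h) \<Rightarrow> ('k::chilbert_space \<Rightarrow>\<^sub>L 'k)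
    \<Rightarrow> ('h \<Rightarrow>\<^sub>L 'h) \<Rightarrow> ('k \<Rightarrow>\<^sub>L 'k) \<Rightarrow> bool" where
  "pullback_rel f U V T S \<longleftrightarrow>
    (\<exists>q r. laurent U q T \<and> laurent V r S \<and> (\<forall>y\<in>spectrum V. r y = q (f y)))"

text \<open>Functions of the form a + b z + c \<open>cnj\<close> z are closed under composition; the
  displayed coefficients are those of the composite.\<close>

lemma pullback_rel_exists:
  assumes T: "T \<in> OSy U" shows "\<exists>S\<in>OSy V. pullback_rel (trig a b c) U V T S"
proof -
  obtain \<alpha> \<beta> \<gamma> where T: "T = trig_op U \<alpha> \<beta> \<gamma>" using T OSy_iff by blast
  let ?a = "\<alpha> + \<beta> * a + \<gamma> * cnj a" and ?b = "\<beta> * b + \<gamma> * cnj c" and ?c = "\<beta> * c + \<gamma> * cnj b"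
  have "trig ?a ?b ?c y = trig \<alpha> \<beta> \<gamma> (trig a b c y)" for y
    by (simp add: trig_def algebra_simps)
  then have "pullback_rel (trig a b c) U V T (trig_op V ?a ?b ?c)"
    unfolding pullback_rel_def T
    by (intro exI[of _ "trig \<alpha> \<beta> \<gamma>"] exI[of _ "trig ?a ?b ?c"] conjI ballI laurent_trig_op)
  then show ?thesis using OSy_iff by blast
qed

lemma pullback_rel_sym:
  assumes "pullback_rel f U V T S" "\<And>x. x \<in> spectrum U \<Longrightarrow> g x \<in> spectrum V \<and> f (g x) = x"
  shows "pullback_rel g V U S T"
proof -
  obtain q r where qr: "laurent U q T" "laurent V r S" "\<And>y. y \<in> spectrum V \<Longrightarrow> r y = q (f y)"
    using assms(1) unfolding pullback_rel_def by blast
  then have "\<forall>x\<in>spectrum U. q x = r (g x)" using assms(2) by simp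
  then show ?thesis unfolding pullback_rel_def using qr by blast
qed

lemma pullback_rel_add:
  assumes "pullback_rel f U V T S" "pullback_rel f U V T' S'"
  shows "pullback_rel f U V (T + T') (S + S')"
proof -
  obtain q r q' r' where qr: "laurent U q T" "laurent V r S" "\<forall>y\<in>spectrum V. r y = q (f y)"
    "laurent U q' T'" "laurent V r' S'" "\<forall>y\<in>spectrum V. r' y = q' (f y)"
    using assms unfolding pullback_rel_def by blast
  have "\<forall>y\<in>spectrum V. r y + r' y = q (f y) + q' (f y)" using qr(3,6) by simp
  then show ?thesis
    unfolding pullback_rel_def using laurent_add[OF qr(1,4)] laurent_add[OF qr(2,5)] by blast
qed

lemma pullback_rel_scale:
  assumes "pullback_rel f U V T S" shows "pullback_rel f U V (d *\<^sub>C T) (d *\<^sub>C S)"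
proof -
  obtain q r where qr: "laurent U q T" "laurent V r S" "\<forall>y\<in>spectrum V. r y = q (f y)"
    using assms unfolding pullback_rel_def by blast
  have "\<forall>y\<in>spectrum V. d * r y = d * q (f y)" using qr(3) by simp
  then show ?thesis
    unfolding pullback_rel_def using laurent_scale[OF qr(1)] laurent_scale[OF qr(2)] by blast
qed

lemma pullback_rel_id: "pullback_rel f U V id_blinfun id_blinfun"
  unfolding pullback_rel_def
  using laurent_const[of U 1] laurent_const[of V 1]
  by (intro exI[of _ "\<lambda>_. 1"] conjI ballI) (simp_all add: scaleC_one)

context
  fixes U :: "'h::chilbert_space \<Rightarrow>\<^sub>L 'h" and V :: "'k::chilbert_space \<Rightarrow>\<^sub>L 'k" and f
  assumes U: "unitary U" and V: "unitary V" and f: "f ` spectrum V \<subseteq> spectrum U"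
begin

text \<open>The reason a relation can replace a formula in coefficients: two functions of the same T
  agree on the spectrum of \<open>U\<close>, which contains all the points f y. Linearity of any
  choice of pullbacks follows from this.\<close>

lemma pullback_rel_unique:
  assumes "pullback_rel f U V T S" "pullback_rel f U V T S'" shows "S = S'"
proof -
  obtain q r where qr: "laurent U q T" "laurent V r S" "\<And>y. y \<in> spectrum V \<Longrightarrow> r y = q (f y)"
    using assms(1) unfolding pullback_rel_def by blast
  obtain q' r' where qr': "laurent U q' T" "laurent V r' S'" "\<And>y. y \<in> spectrum V \<Longrightarrow> r' y = q' (f y)"
    using assms(2) unfolding pullback_rel_def by blast
  show ?thesis
  proof (rule laurent_eqI[OF V qr(2) qr'(2)])
    fix y assume y: "y \<in> spectrum V"
    then have "f y \<in> spectrum U" using f by blast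
    then have "q (f y) = q' (f y)" by (rule laurent_values_unique[OF U qr(1) qr'(1)])
    then show "r y = r' y" using qr(3) qr'(3) y by simp
  qed
qed

text \<open>The scalar matrix of the image at y is the scalar matrix of the argument at f y, a point
  of the spectrum of \<open>U\<close>, so the pointwise criterion transfers positivity for every
  matrix size.\<close>

lemma pullback_ucp:
  assumes \<phi>: "\<And>T. T \<in> OSy U \<Longrightarrow> \<phi> T \<in> OSy V \<and> pullback_rel f U V T (\<phi> T)"
  shows "unital_completely_positive (OSy U) (OSy V) \<phi>"
  unfolding unital_completely_positive_def
proof (intro conjI ballI allI impI)
  show "\<phi> ` OSy U \<subseteq> OSy V" using \<phi> by blast
  show "\<phi> (S + T) = \<phi> S + \<phi> T" if "S \<in> OSy U" "T \<in> OSy U" for S T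
    using \<phi> that OSy_add by (intro pullback_rel_unique[OF _ pullback_rel_add]) blast+
  show "\<phi> (c *\<^sub>C T) = c *\<^sub>C \<phi> T" if "T \<in> OSy U" for c T
    using \<phi> that OSy_scale by (intro pullback_rel_unique[OF _ pullback_rel_scale]) blast+
  show "\<phi> id_blinfun = id_blinfun"
    using \<phi> OSy_generators(1) by (intro pullback_rel_unique[OF _ pullback_rel_id]) blast
next
  fix n x assume x: "\<forall>i<n. \<forall>j<n. x i j \<in> OSy U" and pos: "matrix_positive n x"
  have "\<forall>i j. \<exists>q r. i < n \<longrightarrow> j < n \<longrightarrow> laurent U q (x i j) \<and> laurent V r (\<phi> (x i j)) \<and>
      (\<forall>y\<in>spectrum V. r y = q (f y))"
    using \<phi> x unfolding pullback_rel_def by blast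
  then obtain q r where qr: "\<And>i j. i < n \<Longrightarrow> j < n \<Longrightarrow> laurent U (q i j) (x i j)"
    "\<And>i j. i < n \<Longrightarrow> j < n \<Longrightarrow> laurent V (r i j) (\<phi> (x i j))"
    "\<And>i j y. i < n \<Longrightarrow> j < n \<Longrightarrow> y \<in> spectrum V \<Longrightarrow> r i j y = q i j (f y)"
    by metis
  have "(\<Sum>i<n. \<Sum>j<n. r i j y * v j * cnj (v i)) \<in> \<real>\<^sub>\<ge>\<^sub>0" if y: "y \<in> spectrum V" for y v
  proof -
    have "(\<Sum>i<n. \<Sum>j<n. r i j y * v j * cnj (v i)) = (\<Sum>i<n. \<Sum>j<n. q i j (f y) * v j * cnj (v i))"
      using y by (intro sum.cong refl) (simp add: qr(3))
    moreover have "f y \<in> spectrum U" using f y by blast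
    then have "(\<Sum>i<n. \<Sum>j<n. q i j (f y) * v j * cnj (v i)) \<in> \<real>\<^sub>\<ge>\<^sub>0"
      by (intro laurent_matrix_positive_pointwise[OF U _ pos]) (auto intro: qr(1))
    ultimately show ?thesis by simp
  qed
  then show "matrix_positive n (\<lambda>i j. \<phi> (x i j))"
    using laurent_matrix_positive_iff[OF V, of n r "\<lambda>i j. \<phi> (x i j)"] qr(2) by blast
qed

end

theorem completely_order_isomorphicI:
  fixes U :: "'h::chilbert_space \<Rightarrow>\<^sub>L 'h" and V :: "'k::chilbert_space \<Rightarrow>\<^sub>L 'k"
  assumes U: "unitary U" and V: "unitary V"
    and f: "\<And>y. y \<in> spectrum V \<Longrightarrow> trig a b c y \<in> spectrum U \<and> trig a' b' c' (trig a b c y) = y"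
    and g: "\<And>x. x \<in> spectrum U \<Longrightarrow> trig a' b' c' x \<in> spectrum V \<and> trig a b c (trig a' b' c' x) = x"
  shows "completely_order_isomorphic (OSy U) (OSy V)"
proof -
  let ?f = "trig a b c" and ?g = "trig a' b' c'"
  have f': "?f ` spectrum V \<subseteq> spectrum U" and g': "?g ` spectrum U \<subseteq> spectrum V" using f g by blast+
  have "\<forall>T\<in>OSy U. \<exists>S. S \<in> OSy V \<and> pullback_rel ?f U V T S" using pullback_rel_exists by blast
  then obtain \<phi> where \<phi>: "\<And>T. T \<in> OSy U \<Longrightarrow> \<phi> T \<in> OSy V \<and> pullback_rel ?f U V T (\<phi> T)" by metis
  have rel_g: "pullback_rel ?g V U (\<phi> T) T" if "T \<in> OSy U" for T
    using pullback_rel_sym[OF conjunct2[OF \<phi>[OF that]] g] .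
  have inj: "inj_on \<phi> (OSy U)"
  proof (rule inj_onI)
    fix S T assume *: "S \<in> OSy U" "T \<in> OSy U" "\<phi> S = \<phi> T"
    then show "S = T" using pullback_rel_unique[OF V U g' rel_g[OF *(1)]] rel_g[OF *(2)] by simp
  qed
  have surj: "\<exists>T\<in>OSy U. \<phi> T = S" if S: "S \<in> OSy V" for S
  proof -
    obtain T where T: "T \<in> OSy U" "pullback_rel ?g V U S T" using pullback_rel_exists[OF S] by blast
    have "pullback_rel ?f U V T S" by (rule pullback_rel_sym[OF T(2) f])
    then have "\<phi> T = S" using pullback_rel_unique[OF U V f'] \<phi>[OF T(1)] by blast
    then show ?thesis using T(1) by blast
  qed
  have bij: "bij_betw \<phi> (OSy U) (OSy V)"
    unfolding bij_betw_def using inj surj \<phi> by blast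
  moreover have "unital_completely_positive (OSy U) (OSy V) \<phi>" by (rule pullback_ucp[OF U V f' \<phi>])
  moreover have "unital_completely_positive (OSy V) (OSy U) (inv_into (OSy U) \<phi>)"
  proof (rule pullback_ucp[OF V U g'])
    fix S assume "S \<in> OSy V"
    then have "inv_into (OSy U) \<phi> S \<in> OSy U" "\<phi> (inv_into (OSy U) \<phi> S) = S"
      using bij by (auto simp: bij_betw_def inv_into_into f_inv_into_f)
    then show "inv_into (OSy U) \<phi> S \<in> OSy U \<and> pullback_rel ?g V U S (inv_into (OSy U) \<phi> S)"
      using rel_g by metis
  qed
  ultimately show ?thesis
    unfolding completely_order_isomorphic_def complete_order_isomorphism_def by blast
qed

text \<open>On the circle, the squared modulus of a + b w + c/w is, up to the factor w^2, a polynomial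
  of degree at most 4.\<close>

lemma trig_unimodular:
  assumes Y: "Y \<subseteq> sphere 0 1" "infinite Y \<or> card Y \<ge> 5"
    and unimod: "\<And>y. y \<in> Y \<Longrightarrow> cmod (trig a b c y) = 1" and inj: "inj_on (trig a b c) Y"
  shows "a = 0 \<and> (b = 0 \<and> cmod c = 1 \<or> c = 0 \<and> cmod b = 1)"
proof -
  obtain Z where Z: "Z \<subseteq> Y" "finite Z" "card Z = 5"
  proof (cases "finite Y")
    case True
    then show thesis using Y(2) that obtain_subset_with_card_n[of 5 Y] by metis
  next
    case False
    then show thesis using that infinite_arbitrarily_large[of Y 5] by blast
  qed
  \<comment> \<open>On the circle its value at y is y^2 (|a + b y + c \<open>cnj\<close> y|^2 - 1):
    each of the two conjugate factors is multiplied by y.\<close>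
  define p where "p = [:c * cnj b, c * cnj a + a * cnj b, c * cnj c + a * cnj a + b * cnj b - 1,
    a * cnj c + b * cnj a, b * cnj c:]"
  have root: "poly p y = 0" if y: "y \<in> Z" for y
  proof -
    have y1: "cmod y = 1" using y Z Y(1) by auto
    have yy: "y * cnj y = 1" using y1 complex_norm_square[of y] by simp
    have "trig a b c y * cnj (trig a b c y) = 1"
      using unimod[of y] y Z complex_norm_square[of "trig a b c y"] by auto
    moreover have "y * trig a b c y = c + a * y + b * y\<^sup>2"
      using yy by (simp add: trig_def algebra_simps power2_eq_square)
    moreover have "y * cnj (trig a b c y) = cnj b + cnj a * y + cnj c * y\<^sup>2"
      using yy by (simp add: trig_def algebra_simps power2_eq_square)
    ultimately have "(c + a * y + b * y\<^sup>2) * (cnj b + cnj a * y + cnj c * y\<^sup>2) = y\<^sup>2"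
      by (metis mult.assoc mult.left_commute mult.right_neutral power2_eq_square)
    then show ?thesis by (simp add: p_def power2_eq_square algebra_simps)
  qed
  have "p = 0"
  proof (rule ccontr)
    assume "p \<noteq> 0"
    have "degree p \<le> 4" by (simp add: p_def)
    moreover have "card {x. poly p x = 0} \<le> degree p" by (rule card_poly_roots_bound[OF \<open>p \<noteq> 0\<close>])
    moreover have "card Z \<le> card {x. poly p x = 0}"
      using root by (intro card_mono poly_roots_finite \<open>p \<noteq> 0\<close>) auto
    ultimately show False using Z(3) by simp
  qed
  then have co: "c * cnj b = 0" "c * cnj a + a * cnj b = 0" "c * cnj c + a * cnj a + b * cnj b = 1"
    by (simp_all add: p_def)
  \<comment> \<open>Injectivity excludes the constant functions of modulus 1.\<close>
  have not0: "\<not> (b = 0 \<and> c = 0)"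
  proof
    assume "b = 0 \<and> c = 0"
    then have "trig a b c y = a" for y by (simp add: trig_def)
    then have "card Z \<le> 1" using inj_on_subset[OF inj Z(1)] Z(2) by (metis card_le_Suc0_iff_eq One_nat_def inj_onD)
    then show False using Z(3) by simp
  qed
  show ?thesis
  proof (cases "b = 0")
    case True
    then have "c \<noteq> 0" "a = 0" using not0 co(2) by auto
    moreover have "(cmod c)\<^sup>2 = 1"
      using co(3) True \<open>a = 0\<close> complex_norm_square[of c] by (simp flip: of_real_power)
    then have "cmod c = 1" by (metis norm_ge_zero real_sqrt_one real_sqrt_unique)
    ultimately show ?thesis using True by simp
  next
    case False
    then have "c = 0" "a = 0" using co(1,2) by auto
    moreover have "(cmod b)\<^sup>2 = 1"
      using co(3) \<open>c = 0\<close> \<open>a = 0\<close> complex_norm_square[of b] by (simp flip: of_real_power)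
    then have "cmod b = 1" by (metis norm_ge_zero real_sqrt_one real_sqrt_unique)
    ultimately show ?thesis by simp
  qed
qed

text \<open>Newton's step: the correction is a multiple of the product of y-factors that vanishes on
  the old nodes. Vanishing of the coefficients from \<open>card Y\<close> on is used instead of a
  strict degree bound because it also covers the empty set, with p = 0.\<close>

lemma lagrange_interpolation:
  fixes t :: "'a::field \<Rightarrow> 'a"
  assumes "finite Y"
  shows "\<exists>p. (\<forall>y\<in>Y. poly p y = t y) \<and> (\<forall>i\<ge>card Y. coeff p i = 0)"
  using assms
proof (induction Y rule: finite_induct)
  case (insert x Y)
  then obtain p where p: "\<And>y. y \<in> Y \<Longrightarrow> poly p y = t y" "\<And>i. i \<ge> card Y \<Longrightarrow> coeff p i = 0" by blast
  define m where "m = (\<Prod>y\<in>Y. [:- y, 1:])"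
  have mx: "poly m x \<noteq> 0" using insert by (simp add: m_def poly_prod)
  have my: "poly m y = 0" if "y \<in> Y" for y
    using that insert.hyps(1) by (force simp: m_def poly_prod)
  have "degree m \<le> (\<Sum>y\<in>Y. degree [:- y, 1:])"
    unfolding m_def using degree_prod_sum_le[OF insert.hyps(1), of "\<lambda>y. [:- y, 1:]"] by (simp add: o_def)
  then have dm: "degree m \<le> card Y" by simp
  show ?case
  proof (intro exI conjI ballI allI impI)
    let ?p = "p + smult ((t x - poly p x) / poly m x) m"
    show "poly ?p y = t y" if "y \<in> insert x Y" for y using that p(1) mx my by auto
    show "coeff ?p i = 0" if "i \<ge> card (insert x Y)" for i
      using that insert.hyps p(2) dm by (simp add: coeff_eq_0)
  qed
qed (auto intro: exI[of _ 0])

text \<open>Multiplied by y, a function a + b y + c \<open>cnj\<close> y becomes c + a y + b y^2 on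
  the circle. Interpolating y * t y by a polynomial of degree at most 2 therefore yields all three
  coefficients.\<close>

lemma trig_interpolation:
  assumes "finite Y" "card Y \<le> 3" "Y \<subseteq> sphere 0 1"
  shows "\<exists>a b c. \<forall>y\<in>Y. trig a b c y = t y"
proof -
  obtain p where p: "\<And>y. y \<in> Y \<Longrightarrow> poly p y = y * t y" "\<And>i. i \<ge> card Y \<Longrightarrow> coeff p i = 0"
    using lagrange_interpolation[OF assms(1), of "\<lambda>y. y * t y"] by blast
  have "p = [:coeff p 0, coeff p 1, coeff p 2:]"
  proof (rule poly_eqI)
    fix i
    show "coeff p i = coeff [:coeff p 0, coeff p 1, coeff p 2:] i"
      using p(2)[of i] assms(2) by (auto simp: coeff_pCons numeral_2_eq_2 split: nat.split)
  qed
  then have poly_eq: "poly p y = coeff p 0 + y * (coeff p 1 + y * coeff p 2)" for y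
    by (metis add.right_neutral mult_zero_right poly_0 poly_pCons)
  have "trig (coeff p 1) (coeff p 2) (coeff p 0) y = t y" if y: "y \<in> Y" for y
  proof -
    have yy: "cnj y * y = 1"
      using y assms(3) complex_norm_square[of y] by (auto simp: mult.commute)
    have "trig (coeff p 1) (coeff p 2) (coeff p 0) y =
        cnj y * coeff p 0 + (cnj y * y) * (coeff p 1 + y * coeff p 2)"
      unfolding yy by (simp add: trig_def mult.commute)
    also have "\<dots> = cnj y * poly p y" unfolding poly_eq by (simp add: algebra_simps)
    also have "\<dots> = (cnj y * y) * t y" using p(1)[OF y] by simp
    finally show ?thesis unfolding yy by simp
  qed
  then show ?thesis by blast
qed

theorem theorem4p7:
  fixes U V :: "'h::chilbert_space \<Rightarrow>\<^sub>L 'h"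
  assumes separable: "separable_space (euclidean :: 'h topology)"
    and infinite_dimensional: "\<nexists>B :: 'h set. finite B \<and> cspan B = UNIV"
    and "unitary U" and "unitary V"
  shows
    "(infinite (spectrum V) \<or> card (spectrum V) \<ge> 5 \<longrightarrow>
        ((\<exists>\<pi>. star_isomorphism (cstar_generated U) (cstar_generated V) \<pi> \<and>
              (\<exists>c\<in>sphere (0::complex) 1. \<pi> U = c *\<^sub>C V \<or> \<pi> U = c *\<^sub>C adj V))
         \<longleftrightarrow>
         (\<exists>c\<in>sphere (0::complex) 1.
              spectrum U = (\<lambda>z. c * z) ` spectrum V \<or>
              spectrum U = (\<lambda>z. c * z) ` (cnj ` spectrum V)))
        \<and>
        ((\<exists>c\<in>sphere (0::complex) 1.
              spectrum U = (\<lambda>z. c * z) ` spectrum V \<or>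
              spectrum U = (\<lambda>z. c * z) ` (cnj ` spectrum V))
         \<longleftrightarrow>
         completely_order_isomorphic (OSy U) (OSy V)))
     \<and>
     (finite (spectrum V) \<and> card (spectrum V) \<le> 3 \<longrightarrow>
        (completely_order_isomorphic (OSy U) (OSy V) \<longleftrightarrow> spectrum U \<approx> spectrum V))"
    (is "(?large \<longrightarrow> (?iso \<longleftrightarrow> ?rot) \<and> (?rot \<longleftrightarrow> ?coi)) \<and> (?small \<longrightarrow> (?coi \<longleftrightarrow> ?eq))")
proof -
  note U = assms(3) and V = assms(4)
  let ?X = "spectrum U" and ?Y = "spectrum V"
  have sph: "?X \<subseteq> sphere 0 1" "?Y \<subseteq> sphere 0 1"
    using spectrum_norm[OF U] spectrum_norm[OF V] by auto
  \<comment> \<open>Rotating or conjugating \<open>V\<close> leaves the generated algebra unchanged,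
    so the first equivalence reduces to \<pi> U = W for a unitary W with known spectrum.\<close>
  have W: "unitary (c *\<^sub>C V)" "unitary (c *\<^sub>C adj V)"
    "spectrum (c *\<^sub>C V) = (\<lambda>z. c * z) ` ?Y" "spectrum (c *\<^sub>C adj V) = (\<lambda>z. c * z) ` (cnj ` ?Y)"
    "cstar_generated (c *\<^sub>C V) = cstar_generated V" "cstar_generated (c *\<^sub>C adj V) = cstar_generated V"
    if "c \<in> sphere 0 1" for c
  proof -
    have c: "cmod c = 1" "c \<noteq> 0" using that by auto
    show "unitary (c *\<^sub>C V)" "unitary (c *\<^sub>C adj V)"
      using unitary_cscale[OF V c(1)] unitary_cscale[OF unitary_adj[OF V] c(1)] .
    show "spectrum (c *\<^sub>C V) = (\<lambda>z. c * z) ` ?Y" "spectrum (c *\<^sub>C adj V) = (\<lambda>z. c * z) ` (cnj ` ?Y)"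
      using spectrum_cscale[OF V c(1)] spectrum_cscale[OF unitary_adj[OF V] c(1)]
      by (simp_all add: spectrum_adj[OF V])
    show "cstar_generated (c *\<^sub>C V) = cstar_generated V" "cstar_generated (c *\<^sub>C adj V) = cstar_generated V"
      by (simp_all add: cstar_generated_cscale[OF c(2)] cstar_generated_adj[OF V])
  qed
  have iso_rot: "?iso \<longleftrightarrow> ?rot"
  proof
    assume ?iso
    then obtain \<pi> c where \<pi>: "star_isomorphism (cstar_generated U) (cstar_generated V) \<pi>"
      and c: "c \<in> sphere (0::complex) 1" and \<pi>U: "\<pi> U = c *\<^sub>C V \<or> \<pi> U = c *\<^sub>C adj V" by blast
    from \<pi>U show ?rot
    proof
      assume "\<pi> U = c *\<^sub>C V"
      with star_isomorphism_spectrum_eq[OF U W(1)[OF c]] \<pi> W(3,5)[OF c]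
      have "?X = (\<lambda>z. c * z) ` ?Y" by metis
      then show ?rot using c by blast
    next
      assume "\<pi> U = c *\<^sub>C adj V"
      with star_isomorphism_spectrum_eq[OF U W(2)[OF c]] \<pi> W(4,6)[OF c]
      have "?X = (\<lambda>z. c * z) ` (cnj ` ?Y)" by metis
      then show ?rot using c by blast
    qed
  next
    assume ?rot
    then obtain c where c: "c \<in> sphere (0::complex) 1"
      and rot: "?X = (\<lambda>z. c * z) ` ?Y \<or> ?X = (\<lambda>z. c * z) ` (cnj ` ?Y)" by blast
    from rot show ?iso
    proof
      assume "?X = (\<lambda>z. c * z) ` ?Y"
      with star_isomorphism_of_spectrum_eq[OF U W(1)[OF c]] W(3,5)[OF c] c show ?iso by metis
    next
      assume "?X = (\<lambda>z. c * z) ` (cnj ` ?Y)"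
      with star_isomorphism_of_spectrum_eq[OF U W(2)[OF c]] W(4,6)[OF c] c show ?iso by metis
    qed
  qed
  have rot_coi: ?coi if r: ?rot
  proof -
    obtain c where c: "c \<in> sphere (0::complex) 1"
      and rot: "?X = (\<lambda>z. c * z) ` ?Y \<or> ?X = (\<lambda>z. c * z) ` (cnj ` ?Y)" using r by blast
    have cc: "c * cnj c = 1" using c complex_norm_square[of c] by simp
    from rot show ?coi
    proof
      assume "?X = (\<lambda>z. c * z) ` ?Y"
      then have eq: "?X = (\<lambda>z. c * z) ` ?Y" .
      have inv: "cnj c * (c * y) = y" for y using cc by (metis mult.assoc mult.commute mult_1)
      \<comment> \<open>The rotation z \<mapsto> c z is inverted by z \<mapsto> \<open>cnj\<close> c
        * z.\<close>
      show ?coi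
        by (intro completely_order_isomorphicI[OF U V, of 0 c 0 0 "cnj c" 0])
          (auto simp: trig_def eq inv cc)
    next
      assume "?X = (\<lambda>z. c * z) ` (cnj ` ?Y)"
      then have eq: "?X = (\<lambda>z. c * z) ` (cnj ` ?Y)" .
      have inv: "c * (cnj c * y) = y" for y using cc by (metis mult.assoc mult_1)
      \<comment> \<open>The reflection z \<mapsto> c * \<open>cnj\<close> z is an involution, hence
        the same coefficients in both directions.\<close>
      show ?coi
        by (intro completely_order_isomorphicI[OF U V, of 0 0 c 0 0 c])
          (auto simp: trig_def eq inv cc)
    qed
  qed
  have coi_rot: ?rot if large: ?large and coi: ?coi
  proof -
    obtain a b c a' b' c' where
      f: "\<forall>y\<in>?Y. trig a b c y \<in> ?X \<and> trig a' b' c' (trig a b c y) = y" and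
      g: "\<forall>x\<in>?X. trig a' b' c' x \<in> ?Y \<and> trig a b c (trig a' b' c' x) = x"
      using completely_order_isomorphicD[OF U V coi] by blast
    \<comment> \<open>The mutually inverse maps make the spectrum of \<open>U\<close> the full
      image, so the rigid form of the function determines it.\<close>
    have X: "?X = trig a b c ` ?Y" using f g by (force simp: image_iff)
    have "inj_on (trig a b c) ?Y" using f by (metis inj_onI)
    moreover have "cmod (trig a b c y) = 1" if "y \<in> ?Y" for y
      using f that spectrum_norm[OF U] by blast
    ultimately have "a = 0 \<and> (b = 0 \<and> cmod c = 1 \<or> c = 0 \<and> cmod b = 1)"
      using trig_unimodular[OF sph(2)] large by blast
    then consider "a = 0" "b = 0" "cmod c = 1" | "a = 0" "c = 0" "cmod b = 1" by blast
    then show ?rot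
    proof cases
      case 1
      then have "?X = (\<lambda>z. c * z) ` (cnj ` ?Y)" by (simp add: X trig_def image_image)
      then show ?rot using 1 by (intro bexI[of _ c]) auto
    next
      case 2
      then have "?X = (\<lambda>z. b * z) ` ?Y" by (simp add: X trig_def)
      then show ?rot using 2 by (intro bexI[of _ b]) auto
    qed
  qed
  have small: "?coi \<longleftrightarrow> ?eq" if sm: ?small
  proof
    assume ?coi
    from completely_order_isomorphicD[OF U V this]
    obtain f g where "\<forall>y\<in>?Y. f y \<in> ?X \<and> g (f y) = y" "\<forall>x\<in>?X. g x \<in> ?Y \<and> f (g x) = x" by blast
    then have "bij_betw g ?X ?Y" by (intro bij_betw_byWitness[of _ f]) auto
    then show ?eq by (auto simp: eqpoll_def)
  next
    assume ?eq
    then obtain g where g: "bij_betw g ?X ?Y" by (auto simp: eqpoll_def)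
    then have X: "finite ?X" "card ?X \<le> 3"
      using sm bij_betw_finite bij_betw_same_card by metis+
    \<comment> \<open>Any bijection between the spectra will do: both it and its inverse are
      interpolated on at most three points.\<close>
    define f where "f = inv_into ?X g"
    obtain a b c where abc: "\<forall>y\<in>?Y. trig a b c y = f y"
      using trig_interpolation[OF _ _ sph(2)] sm by blast
    obtain a' b' c' where abc': "\<forall>x\<in>?X. trig a' b' c' x = g x"
      using trig_interpolation[OF X sph(1)] by blast
    show ?coi
    proof (rule completely_order_isomorphicI[OF U V])
      fix y assume y: "y \<in> ?Y"
      then have "f y \<in> ?X" "g (f y) = y"
        using g by (auto simp: f_def bij_betw_def inv_into_into f_inv_into_f)
      then show "trig a b c y \<in> ?X \<and> trig a' b' c' (trig a b c y) = y" using abc abc' y by simp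
    next
      fix x assume x: "x \<in> ?X"
      then have "g x \<in> ?Y" "f (g x) = x" using g by (auto simp: f_def bij_betw_def)
      then show "trig a' b' c' x \<in> ?Y \<and> trig a b c (trig a' b' c' x) = x" using abc abc' x by simp
    qed
  qed
  show ?thesis using iso_rot rot_coi coi_rot small by blast
qed

end
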